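(* Let $G$ be a countably infinite sofic group and $\Sigma=\{\sigma_i:G\to\mathrm{Sym}(n_i)\}_{i\in\mathbb{N}}$ a sofic approximation sequence for $G$. Suppose that $G\curvearrowright X$ is an expansive action on a compact metrizable space by homeomorphisms which has the topological Markov property. Let $k\ge1$ be an integer and $(x_1,\dots,x_k,x_{k+1})\in X^{k+1}$ such that $(x_1,\dots,x_k)\in\mathrm{IE}^{\Sigma}_k(X,G)$ and $(x_k,x_{k+1})$ is an asymptotic pair. Then $(x_1,\dots,x_k,x_{k+1})\in\mathrm{IE}^{\Sigma}_{k+1}(X,G)$.
   Context: Fix a compatible metric $d$ on $X$ (the notions below do not depend on its choice). For $K\subset G$ and $x,y\in X$ write $d_K(x,y)=\sup_{g\in K}d(gx,gy)$. Sofic approximation sequence: positive integers $n_i\to\infty$ and maps $\sigma_i:G\to\mathrm{Sym}(n_i)$ (permutations of $\{1,\dots,n_i\}$) such that $\frac1{n_i}|\{v:\sigma_i(st)v=\sigma_i(s)\sigma_i(t)v\}|\to1$ for all $s,t\in G$ and $\frac1{n_i}|\{v:\sigma_i(s)v\ne\sigma_i(t)v\}|\to1$ for all $s\neq t$ in $G$. $G$ is sofic if it admits one. Expansive: there is $c>0$ such that for all $x\neq y$ in $X$ there is $g\in G$ with $d(gx,gy)>c$. Asymptotic pair: $(x,y)\in X^2$ such that for every $\varepsilon>0$ there is a finite $F\subset G$ with $d(gx,gy)\le\varepsilon$ for all $g\notin F$. Memory set: for $\varepsilon,\delta>0$ and finite $A\subset B\subset G$, $B$ is an $(\varepsilon,\delta)$-memory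 set for $A$ if for every $x,y\in X$ with $d_{B\setminus A}(x,y)\le\delta$ there is $z\in X$ with $d_B(x,z)\le\varepsilon$ and $d_{G\setminus A}(y,z)\le\varepsilon$. Topological Markov property (TMP): for every $\varepsilon>0$ there is $\delta>0$ such that every finite $A\subset G$ admits an $(\varepsilon,\delta)$-memory set. For finite $F\subset G$, $\delta>0$, $\sigma:G\to\mathrm{Sym}(n)$, $\mathrm{Map}(d,F,\delta,\sigma)$ is the set of maps $\varphi:\{1,\dots,n\}\to X$ with $\big(\frac1n\sum_{v=1}^n d(\varphi(\sigma(s)v),s\varphi(v))^2\big)^{1/2}\le\delta$ for every $s\in F$. For a tuple $\mathbf A=(A_1,\dots,A_k)$ of subsets of $X$, $J\subset\{1,\dots,n\}$ is a $(d,F,\delta,\sigma)$-independence set for $\mathbf A$ if for every $\omega:J\to\{1,\dots,k\}$ there is $\varphi\in\mathrm{Map}(d,F,\delta,\sigma)$ with $\varphi(a)\in A_{\omega(a)}$ for every $a\in J$. $\mathbf A$ has positive upper independence density over $\Sigma$ if there is $q>0$ such that for every finite $F\subset G$ and $\delta>0$ there are infinitely many $i$ for which $\mathbf A$ has a $(d,F,\delta,\sigma_i)$-independence set of cardinality at least $qn_i$. $\mathrm{IE}^\Sigma_k(X,G)$ is the set of $(x_1,\dots,x_k)\in X^k$ such that for every product neighborhood $U_1\times\dots\times U_k$ of it, $(U_1,\dots,U_k)$ has positive upper independence density over $\Sigma$. *)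

theory Defs
  imports "HOL-Analysis.Analysis" "HOL-Algebra.Group_Action"
begin

text \<open>
  The space is a compact subset \<open>X\<close> of a metric-space type, with the subspace topology; the
  compatible metric is \<^const>\<open>dist\<close>. An action is a library \<^locale>\<open>group_action\<close> \<open>\<alpha>\<close>,
  with \<open>\<alpha> g x\<close> for $gx$. Tuples $(a_1,\dots,a_k)$ are functions on \<^typ>\<open>nat\<close>
  of which only the values on \<open>{1..k}\<close> matter, and likewise for maps on $\{1,\dots,n\}$.
\<close>

definition sofic_approximation ::
  "('g, 'm) monoid_scheme \<Rightarrow> (nat \<Rightarrow> nat) \<Rightarrow> (nat \<Rightarrow> 'g \<Rightarrow> nat \<Rightarrow> nat) \<Rightarrow> bool" where
  "sofic_approximation G n \<sigma> \<longleftrightarrow>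
     (\<forall>i. n i > 0) \<and> filterlim n at_top sequentially \<and>
     (\<forall>i. \<forall>g\<in>carrier G. \<sigma> i g permutes {1..n i}) \<and>
     (\<forall>s\<in>carrier G. \<forall>t\<in>carrier G.
        (\<lambda>i. real (card {v \<in> {1..n i}. \<sigma> i (s \<otimes>\<^bsub>G\<^esub> t) v = \<sigma> i s (\<sigma> i t v)}) / real (n i))
          \<longlonglongrightarrow> 1) \<and>
     (\<forall>s\<in>carrier G. \<forall>t\<in>carrier G. s \<noteq> t \<longrightarrow>
        (\<lambda>i. real (card {v \<in> {1..n i}. \<sigma> i s v \<noteq> \<sigma> i t v}) / real (n i)) \<longlonglongrightarrow> 1)"

definition sofic_group :: "('g, 'm) monoid_scheme \<Rightarrow> bool" where
  "sofic_group G \<longleftrightarrow> group G \<and> (\<exists>n \<sigma>. sofic_approximation G n \<sigma>)"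

definition action_by_homeomorphisms ::
  "('g, 'm) monoid_scheme \<Rightarrow> 'x::metric_space set \<Rightarrow> ('g \<Rightarrow> 'x \<Rightarrow> 'x) \<Rightarrow> bool" where
  "action_by_homeomorphisms G X \<alpha> \<longleftrightarrow>
     group_action G X \<alpha> \<and>
     (\<forall>g\<in>carrier G. homeomorphic_map (top_of_set X) (top_of_set X) (\<alpha> g))"

definition expansive ::
  "('g, 'm) monoid_scheme \<Rightarrow> 'x::metric_space set \<Rightarrow> ('g \<Rightarrow> 'x \<Rightarrow> 'x) \<Rightarrow> bool" where
  "expansive G X \<alpha> \<longleftrightarrow>
     (\<exists>c>0. \<forall>x\<in>X. \<forall>y\<in>X. x \<noteq> y \<longrightarrow> (\<exists>g\<in>carrier G. dist (\<alpha> g x) (\<alpha> g y) > c))"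

definition asymptotic_pair ::
  "('g, 'm) monoid_scheme \<Rightarrow> 'x::metric_space set \<Rightarrow> ('g \<Rightarrow> 'x \<Rightarrow> 'x) \<Rightarrow> 'x \<Rightarrow> 'x \<Rightarrow> bool" where
  "asymptotic_pair G X \<alpha> x y \<longleftrightarrow>
     x \<in> X \<and> y \<in> X \<and>
     (\<forall>\<epsilon>>0. \<exists>F. finite F \<and> F \<subseteq> carrier G \<and>
        (\<forall>g\<in>carrier G - F. dist (\<alpha> g x) (\<alpha> g y) \<le> \<epsilon>))"

text \<open>The supremum of distances over the empty set is 0; the real-valued \<^const>\<open>Sup\<close> is
  unspecified there.\<close>

definition dist_on :: "('g \<Rightarrow> 'x \<Rightarrow> 'x::metric_space) \<Rightarrow> 'g set \<Rightarrow> 'x \<Rightarrow> 'x \<Rightarrow> real" where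
  "dist_on \<alpha> K x y = (if K = {} then 0 else (SUP g\<in>K. dist (\<alpha> g x) (\<alpha> g y)))"

text \<open>Memory sets are finite: with \<open>B = carrier G\<close> the condition would hold for all actions
  (take \<open>z = x\<close> and \<open>\<delta> \<le> \<epsilon>\<close>).\<close>

definition memory_set ::
  "('g, 'm) monoid_scheme \<Rightarrow> 'x::metric_space set \<Rightarrow> ('g \<Rightarrow> 'x \<Rightarrow> 'x) \<Rightarrow> real \<Rightarrow> real
     \<Rightarrow> 'g set \<Rightarrow> 'g set \<Rightarrow> bool" where
  "memory_set G X \<alpha> \<epsilon> \<delta> A B \<longleftrightarrow>
     finite B \<and> A \<subseteq> B \<and> B \<subseteq> carrier G \<and>
     (\<forall>x\<in>X. \<forall>y\<in>X. dist_on \<alpha> (B - A) x y \<le> \<delta> \<longrightarrow>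
        (\<exists>z\<in>X. dist_on \<alpha> B x z \<le> \<epsilon> \<and> dist_on \<alpha> (carrier G - A) y z \<le> \<epsilon>))"

definition topological_Markov_property ::
  "('g, 'm) monoid_scheme \<Rightarrow> 'x::metric_space set \<Rightarrow> ('g \<Rightarrow> 'x \<Rightarrow> 'x) \<Rightarrow> bool" where
  "topological_Markov_property G X \<alpha> \<longleftrightarrow>
     (\<forall>\<epsilon>>0. \<exists>\<delta>>0. \<forall>A. finite A \<and> A \<subseteq> carrier G \<longrightarrow> (\<exists>B. memory_set G X \<alpha> \<epsilon> \<delta> A B))"

definition Map ::
  "'x::metric_space set \<Rightarrow> ('g \<Rightarrow> 'x \<Rightarrow> 'x) \<Rightarrow> 'g set \<Rightarrow> real \<Rightarrow> nat \<Rightarrow> ('g \<Rightarrow> nat \<Rightarrow> nat)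
     \<Rightarrow> (nat \<Rightarrow> 'x) set" where
  "Map X \<alpha> F \<delta> n \<sigma> =
     {\<phi> \<in> {1..n} \<rightarrow> X.
        \<forall>s\<in>F. sqrt (1 / real n * (\<Sum>v=1..n. (dist (\<phi> (\<sigma> s v)) (\<alpha> s (\<phi> v)))\<^sup>2)) \<le> \<delta>}"

definition independence_set ::
  "'x::metric_space set \<Rightarrow> ('g \<Rightarrow> 'x \<Rightarrow> 'x) \<Rightarrow> 'g set \<Rightarrow> real \<Rightarrow> nat \<Rightarrow> ('g \<Rightarrow> nat \<Rightarrow> nat)
     \<Rightarrow> nat \<Rightarrow> (nat \<Rightarrow> 'x set) \<Rightarrow> nat set \<Rightarrow> bool" where
  "independence_set X \<alpha> F \<delta> n \<sigma> k A J \<longleftrightarrow>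
     J \<subseteq> {1..n} \<and>
     (\<forall>\<omega> \<in> J \<rightarrow> {1..k}. \<exists>\<phi> \<in> Map X \<alpha> F \<delta> n \<sigma>. \<forall>a\<in>J. \<phi> a \<in> A (\<omega> a))"

definition positive_upper_independence_density ::
  "('g, 'm) monoid_scheme \<Rightarrow> 'x::metric_space set \<Rightarrow> ('g \<Rightarrow> 'x \<Rightarrow> 'x)
     \<Rightarrow> (nat \<Rightarrow> nat) \<Rightarrow> (nat \<Rightarrow> 'g \<Rightarrow> nat \<Rightarrow> nat) \<Rightarrow> nat \<Rightarrow> (nat \<Rightarrow> 'x set) \<Rightarrow> bool" where
  "positive_upper_independence_density G X \<alpha> n \<sigma> k A \<longleftrightarrow>
     (\<exists>q::real>0. \<forall>F \<delta>. finite F \<and> F \<subseteq> carrier G \<and> \<delta> > 0 \<longrightarrow>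
        infinite {i. \<exists>J. independence_set X \<alpha> F \<delta> (n i) (\<sigma> i) k A J \<and>
                         real (card J) \<ge> q * real (n i)})"

definition IE_tuples ::
  "('g, 'm) monoid_scheme \<Rightarrow> 'x::metric_space set \<Rightarrow> ('g \<Rightarrow> 'x \<Rightarrow> 'x)
     \<Rightarrow> (nat \<Rightarrow> nat) \<Rightarrow> (nat \<Rightarrow> 'g \<Rightarrow> nat \<Rightarrow> nat) \<Rightarrow> nat \<Rightarrow> (nat \<Rightarrow> 'x) set" where
  "IE_tuples G X \<alpha> n \<sigma> k =
     {x \<in> {1..k} \<rightarrow> X.
        \<forall>U. (\<forall>j\<in>{1..k}. U j \<subseteq> X \<and>
               (\<exists>V. openin (top_of_set X) V \<and> x j \<in> V \<and> V \<subseteq> U j)) \<longrightarrow>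
            positive_upper_independence_density G X \<alpha> n \<sigma> k U}"

end

theory Submission
  imports Defs
begin

text \<open>
  Let \<open>y\<close> be close to \<open>x k\<close>. As \<open>x k\<close> and \<open>x (k + 1)\<close> are close off a finite set \<open>A\<close>, the Markov
  property yields \<open>z\<close> which is close to \<open>x (k + 1)\<close> on the memory set \<open>B\<close> and close to \<open>y\<close> off \<open>A\<close>;
  by expansivity \<open>z\<close> is even \<open>\<eta>\<close>-close to \<open>y\<close> off a larger finite set \<open>E\<close>. An independence set \<open>J\<close>
  for neighbourhoods of \<open>x 1, \<dots>, x k\<close> contains a subset \<open>J'\<close> of comparable size whose points are pairwise
  \<open>E\<close>-separated. This separation depends on the neighbourhoods only, not on the required quality of the
  microstate, so the density stays bounded below. Given \<open>\<omega>\<close> with values in \<open>{1..k+1}\<close>, take the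
  microstate \<open>\<phi>\<close> for \<open>\<omega>\<close> with \<open>k + 1\<close> replaced by \<open>k\<close>, and near each good vertex modify its orbit at
  the finitely many visible points of \<open>J'\<close> labelled \<open>k + 1\<close>. The points chosen at different vertices are
  all close to \<open>x (k + 1)\<close> near these sites and close to \<open>\<phi>\<close> elsewhere, so by expansivity
  the result is again approximately equivariant.
\<close>

section \<open>Finite combinatorics: common radii and separated subsets\<close>

lemma ex_common_radius:
  fixes P :: "'i \<Rightarrow> real \<Rightarrow> bool"
  assumes "finite I" "\<And>i. i \<in> I \<Longrightarrow> \<exists>e>0. P i e"
    and mono: "\<And>i d e. \<lbrakk>P i e; 0 < d; d \<le> e\<rbrakk> \<Longrightarrow> P i d"
  shows "\<exists>e>0. \<forall>i\<in>I. P i e"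
  using assms(1,2)
proof (induction I)
  case empty
  show ?case by (rule exI[of _ 1]) simp
next
  case (insert j I)
  then obtain e where e: "e > 0" "\<forall>i\<in>I. P i e" by auto
  from insert.prems obtain d where d: "d > 0" "P j d" by blast
  have "P i (min d e)" if "i \<in> insert j I" for i
    using that
  proof
    assume "i = j"
    then show ?thesis using mono[OF d(2), of "min d e"] d e by simp
  next
    assume "i \<in> I"
    then show ?thesis using mono[of i e "min d e"] d e by simp
  qed
  with d e show ?case by (intro exI[of _ "min d e"]) auto
qed

text \<open>A maximal separated \<open>K\<close> works. By maximality every point of
  \<open>J\<close> is in \<open>K\<close>, or is an image or a preimage of a point of
  \<open>K\<close> under some \<open>f d\<close>. A point has at most \<open>card D\<close> images
  and, by injectivity, at most \<open>card D\<close> preimages in \<open>J\<close>, so the sets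
  \<open>N a\<close> have at most \<open>2 * card D + 1\<close> elements and cover
  \<open>J\<close>.\<close>

lemma separated_subset:
  fixes f :: "'d \<Rightarrow> 'a \<Rightarrow> 'a"
  assumes "finite J" "finite D" and inj: "\<And>d. d \<in> D \<Longrightarrow> inj_on (f d) J"
  obtains J' where "J' \<subseteq> J"
    "\<And>a b d. \<lbrakk>a \<in> J'; b \<in> J'; d \<in> D; a \<noteq> b\<rbrakk> \<Longrightarrow> f d a \<noteq> b"
    "card J \<le> (2 * card D + 1) * card J'"
proof -
  define sep where "sep K \<longleftrightarrow> K \<subseteq> J \<and> (\<forall>a\<in>K. \<forall>b\<in>K. \<forall>d\<in>D. a \<noteq> b \<longrightarrow> f d a \<noteq> b)" for K
  have "finite {K. sep K}"
    by (rule finite_subset[of _ "Pow J"]) (use \<open>finite J\<close> in \<open>auto simp: sep_def\<close>)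
  moreover have "sep {}" by (simp add: sep_def)
  ultimately obtain K where K: "sep K" and max: "\<And>L. sep L \<Longrightarrow> K \<subseteq> L \<Longrightarrow> L = K"
    using finite_has_maximal2[of "{K. sep K}" "{}"] by blast
  define N where "N a = insert a ((\<lambda>d. f d a) ` D) \<union> (\<Union>d\<in>D. {b \<in> J. f d b = a})" for a
  have "finite K" using K \<open>finite J\<close> by (auto simp: sep_def intro: finite_subset)
  have cardN: "card (N a) \<le> 2 * card D + 1" for a
  proof -
    have one: "card {b \<in> J. f d b = a} \<le> 1" if "d \<in> D" for d
      using inj[OF that] \<open>finite J\<close> by (intro card_le_Suc0_iff_eq[THEN iffD2, simplified One_nat_def[symmetric]])
        (auto simp: inj_on_def)
    have "card (\<Union>d\<in>D. {b \<in> J. f d b = a}) \<le> (\<Sum>d\<in>D. card {b \<in> J. f d b = a})"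
      using \<open>finite D\<close> by (rule card_UN_le)
    also have "\<dots> \<le> card D" using sum_mono[of D _ "\<lambda>_. 1", OF one] by simp
    finally have "card (\<Union>d\<in>D. {b \<in> J. f d b = a}) \<le> card D" .
    moreover have "card (insert a ((\<lambda>d. f d a) ` D)) \<le> Suc (card D)"
      using card_insert_le_m1 card_image_le[OF \<open>finite D\<close>, of "\<lambda>d. f d a"] \<open>finite D\<close>
      by (metis (no_types, lifting) Suc_le_mono card_insert_if finite_imageI le_Suc_eq)
    ultimately show ?thesis
      unfolding N_def using card_Un_le[of "insert a ((\<lambda>d. f d a) ` D)"
          "\<Union>d\<in>D. {b \<in> J. f d b = a}"] by linarith
  qed
  have finN: "finite (N a)" for a
    using \<open>finite D\<close> \<open>finite J\<close> by (auto simp: N_def)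
  have "J \<subseteq> (\<Union>a\<in>K. N a)"
  proof
    fix b assume "b \<in> J"
    show "b \<in> (\<Union>a\<in>K. N a)"
    proof (rule ccontr)
      assume n: "b \<notin> (\<Union>a\<in>K. N a)"
      then have "b \<notin> K" by (auto simp: N_def)
      moreover have "sep (insert b K)"
        using K n \<open>b \<in> J\<close> unfolding sep_def N_def by auto
      ultimately show False using max[of "insert b K"] by auto
    qed
  qed
  then have "card J \<le> card (\<Union>a\<in>K. N a)"
    using finN \<open>finite K\<close> by (intro card_mono) auto
  also have "\<dots> \<le> (\<Sum>a\<in>K. card (N a))" using \<open>finite K\<close> by (rule card_UN_le)
  also have "\<dots> \<le> (\<Sum>a\<in>K. 2 * card D + 1)" by (rule sum_mono) (rule cardN)
  finally have "card J \<le> (2 * card D + 1) * card K" by (simp add: mult.commute)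
  with K show ?thesis by (intro that[of K]) (auto simp: sep_def)
qed

section \<open>Counting bad vertices\<close>

definition sofic_at :: "('g, 'm) monoid_scheme \<Rightarrow> ('g \<Rightarrow> nat \<Rightarrow> nat) \<Rightarrow> 'g set \<Rightarrow> nat \<Rightarrow> bool" where
  "sofic_at G \<sigma> V v \<longleftrightarrow>
     (\<forall>g\<in>V. \<forall>h\<in>V. \<sigma> (g \<otimes>\<^bsub>G\<^esub> h) v = \<sigma> g (\<sigma> h v) \<and> (g \<noteq> h \<longrightarrow> \<sigma> g v \<noteq> \<sigma> h v))"

text \<open>The bad vertices form a union, over the finitely many pairs from \<open>V\<close>, of
  sets on which multiplicativity or freeness fails; each of these has density tending to 0.\<close>

lemma sofic_at_mostly:
  assumes sofic: "sofic_approximation G n \<sigma>" and V: "finite V" "V \<subseteq> carrier G" and "\<beta> > 0"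
  shows "\<forall>\<^sub>F i in sequentially. real (card {v \<in> {1..n i}. \<not> sofic_at G (\<sigma> i) V v}) \<le> \<beta> * real (n i)"
proof -
  define P1 where "P1 g h i = {v \<in> {1..n i}. \<sigma> i (g \<otimes>\<^bsub>G\<^esub> h) v \<noteq> \<sigma> i g (\<sigma> i h v)}" for g h i
  define P2 where "P2 g h i = {v \<in> {1..n i}. g \<noteq> h \<and> \<sigma> i g v = \<sigma> i h v}" for g h i
  have lim_mult: "\<forall>s\<in>carrier G. \<forall>t\<in>carrier G.
        (\<lambda>i. real (card {v \<in> {1..n i}. \<sigma> i (s \<otimes>\<^bsub>G\<^esub> t) v = \<sigma> i s (\<sigma> i t v)}) / real (n i)) \<longlonglongrightarrow> 1"
    using sofic unfolding sofic_approximation_def by (elim conjE) assumption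
  have lim_free: "\<forall>s\<in>carrier G. \<forall>t\<in>carrier G. s \<noteq> t \<longrightarrow>
        (\<lambda>i. real (card {v \<in> {1..n i}. \<sigma> i s v \<noteq> \<sigma> i t v}) / real (n i)) \<longlonglongrightarrow> 1"
    using sofic unfolding sofic_approximation_def by (elim conjE) assumption
  have npos: "n i > 0" for i using sofic by (auto simp: sofic_approximation_def)
  have compl: "real (card {v \<in> {1..n i}. \<not> Q v}) / real (n i) = 1 - real (card {v \<in> {1..n i}. Q v}) / real (n i)"
    for Q i
  proof -
    have "{v \<in> {1..n i}. \<not> Q v} = {1..n i} - {v \<in> {1..n i}. Q v}" by auto
    moreover have "card ({1..n i} - {v \<in> {1..n i}. Q v}) = n i - card {v \<in> {1..n i}. Q v}"
      by (subst card_Diff_subset) auto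
    ultimately have "card {v \<in> {1..n i}. \<not> Q v} = n i - card {v \<in> {1..n i}. Q v}"
      by (simp only:)
    moreover have "card {v \<in> {1..n i}. Q v} \<le> n i"
    proof -
      have "card {v \<in> {1..n i}. Q v} \<le> card {1..n i}" by (rule card_mono) auto
      then show ?thesis by (simp only: card_atLeastAtMost diff_Suc_1)
    qed
    ultimately show ?thesis using npos[of i] by (simp add: of_nat_diff field_simps)
  qed
  have lim1: "(\<lambda>i. real (card (P1 g h i)) / real (n i)) \<longlonglongrightarrow> 0" if "g \<in> V" "h \<in> V" for g h
  proof -
    have "(\<lambda>i. real (card {v \<in> {1..n i}. \<sigma> i (g \<otimes>\<^bsub>G\<^esub> h) v = \<sigma> i g (\<sigma> i h v)}) / real (n i)) \<longlonglongrightarrow> 1"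
      using lim_mult that V(2) by (simp add: subset_iff)
    then have "(\<lambda>i. 1 - real (card {v \<in> {1..n i}. \<sigma> i (g \<otimes>\<^bsub>G\<^esub> h) v = \<sigma> i g (\<sigma> i h v)}) / real (n i)) \<longlonglongrightarrow> 1 - 1"
      by (intro tendsto_diff tendsto_const)
    moreover have "real (card (P1 g h i)) / real (n i)
        = 1 - real (card {v \<in> {1..n i}. \<sigma> i (g \<otimes>\<^bsub>G\<^esub> h) v = \<sigma> i g (\<sigma> i h v)}) / real (n i)" for i
      unfolding P1_def by (rule compl)
    ultimately show ?thesis by (simp only: diff_self)
  qed
  have lim2: "(\<lambda>i. real (card (P2 g h i)) / real (n i)) \<longlonglongrightarrow> 0" if "g \<in> V" "h \<in> V" for g h
  proof (cases "g = h")
    case False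
    have "(\<lambda>i. real (card {v \<in> {1..n i}. \<sigma> i g v \<noteq> \<sigma> i h v}) / real (n i)) \<longlonglongrightarrow> 1"
      using lim_free that V(2) False by (simp add: subset_iff)
    then have "(\<lambda>i. 1 - real (card {v \<in> {1..n i}. \<sigma> i g v \<noteq> \<sigma> i h v}) / real (n i)) \<longlonglongrightarrow> 1 - 1"
      by (intro tendsto_diff tendsto_const)
    moreover have "real (card (P2 g h i)) / real (n i)
        = 1 - real (card {v \<in> {1..n i}. \<sigma> i g v \<noteq> \<sigma> i h v}) / real (n i)" for i
    proof -
      have "P2 g h i = {v \<in> {1..n i}. \<not> \<sigma> i g v \<noteq> \<sigma> i h v}" using False by (auto simp: P2_def)
      then show ?thesis using compl[where Q = "\<lambda>v. \<sigma> i g v \<noteq> \<sigma> i h v" and i = i] by simp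
    qed
    ultimately show ?thesis by (simp only: diff_self)
  qed (simp add: P2_def)
  have "(\<lambda>i. \<Sum>g\<in>V. \<Sum>h\<in>V. real (card (P1 g h i)) / real (n i) + real (card (P2 g h i)) / real (n i))
      \<longlonglongrightarrow> (\<Sum>g\<in>V. \<Sum>h\<in>V. 0 + 0)"
    by (intro tendsto_sum tendsto_add lim1 lim2)
  then have "\<forall>\<^sub>F i in sequentially. (\<Sum>g\<in>V. \<Sum>h\<in>V. real (card (P1 g h i)) / real (n i)
      + real (card (P2 g h i)) / real (n i)) < \<beta>"
    using \<open>\<beta> > 0\<close> by (auto dest: order_tendstoD(2))
  then show ?thesis
  proof eventually_elim
    case (elim i)
    have fin: "finite (P1 g h i \<union> P2 g h i)" for g h by (auto simp: P1_def P2_def)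
    have "{v \<in> {1..n i}. \<not> sofic_at G (\<sigma> i) V v} \<subseteq> (\<Union>g\<in>V. \<Union>h\<in>V. P1 g h i \<union> P2 g h i)"
      by (auto simp: sofic_at_def P1_def P2_def)
    then have "card {v \<in> {1..n i}. \<not> sofic_at G (\<sigma> i) V v} \<le> card (\<Union>g\<in>V. \<Union>h\<in>V. P1 g h i \<union> P2 g h i)"
      using V(1) fin by (intro card_mono) auto
    also have "\<dots> \<le> (\<Sum>g\<in>V. card (\<Union>h\<in>V. P1 g h i \<union> P2 g h i))"
      using V(1) by (rule card_UN_le)
    also have "\<dots> \<le> (\<Sum>g\<in>V. \<Sum>h\<in>V. card (P1 g h i \<union> P2 g h i))"
      using V(1) by (intro sum_mono card_UN_le)
    also have "\<dots> \<le> (\<Sum>g\<in>V. \<Sum>h\<in>V. card (P1 g h i) + card (P2 g h i))"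
      by (intro sum_mono card_Un_le)
    finally have "real (card {v \<in> {1..n i}. \<not> sofic_at G (\<sigma> i) V v}) / real (n i)
        \<le> real (\<Sum>g\<in>V. \<Sum>h\<in>V. card (P1 g h i) + card (P2 g h i)) / real (n i)"
      by (intro divide_right_mono) (simp_all only: of_nat_le_iff of_nat_0_le_iff)
    also have "\<dots> = (\<Sum>g\<in>V. \<Sum>h\<in>V. real (card (P1 g h i)) / real (n i) + real (card (P2 g h i)) / real (n i))"
      by (simp add: sum_divide_distrib add_divide_distrib)
    also have "\<dots> \<le> \<beta>" using elim by simp
    finally show ?case using npos[of i] by (simp only: pos_divide_le_eq of_nat_0_less_iff)
  qed
qed

section \<open>Passage between mean-square and pointwise equivariance\<close>

lemma Map_sum_le:
  assumes "\<phi> \<in> Map X \<alpha> F \<delta> n \<sigma>" "s \<in> F" "n > 0"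
  shows "(\<Sum>v=1..n. (dist (\<phi> (\<sigma> s v)) (\<alpha> s (\<phi> v)))\<^sup>2) \<le> \<delta>\<^sup>2 * real n"
proof -
  let ?S = "\<Sum>v=1..n. (dist (\<phi> (\<sigma> s v)) (\<alpha> s (\<phi> v)))\<^sup>2"
  have "sqrt (1 / real n * ?S) \<le> \<delta>" using assms unfolding Map_def by blast
  moreover have "0 \<le> 1 / real n * ?S" by (simp add: sum_nonneg)
  ultimately have "1 / real n * ?S \<le> \<delta>\<^sup>2" by (rule_tac sqrt_le_D)
  then show ?thesis using \<open>n > 0\<close> by (simp add: field_simps)
qed

text \<open>Chebyshev's inequality for each \<open>g\<close>, then a union bound over
  \<open>V\<close>. A microstate is thus pointwise almost equivariant off a small set of
  vertices.\<close>

lemma Map_chebyshev: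
  assumes \<phi>: "\<phi> \<in> Map X \<alpha> V \<delta> n \<sigma>" and "finite V" "n > 0" "\<kappa> > 0"
  shows "real (card {v \<in> {1..n}. \<exists>g\<in>V. dist (\<phi> (\<sigma> g v)) (\<alpha> g (\<phi> v)) > \<kappa>}) * \<kappa>\<^sup>2
    \<le> real (card V) * \<delta>\<^sup>2 * real n"
proof -
  define Q where "Q g = {v \<in> {1..n}. dist (\<phi> (\<sigma> g v)) (\<alpha> g (\<phi> v)) > \<kappa>}" for g
  have Q: "real (card (Q g)) * \<kappa>\<^sup>2 \<le> \<delta>\<^sup>2 * real n" if "g \<in> V" for g
  proof -
    have "real (card (Q g)) * \<kappa>\<^sup>2 = (\<Sum>v\<in>Q g. \<kappa>\<^sup>2)" by simp
    also have "\<dots> \<le> (\<Sum>v\<in>Q g. (dist (\<phi> (\<sigma> g v)) (\<alpha> g (\<phi> v)))\<^sup>2)"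
      using \<open>\<kappa> > 0\<close> by (intro sum_mono power_mono) (auto simp: Q_def)
    also have "\<dots> \<le> (\<Sum>v=1..n. (dist (\<phi> (\<sigma> g v)) (\<alpha> g (\<phi> v)))\<^sup>2)"
      by (rule sum_mono2) (auto simp: Q_def)
    also have "\<dots> \<le> \<delta>\<^sup>2 * real n" by (rule Map_sum_le[OF \<phi> that \<open>n > 0\<close>])
    finally show ?thesis .
  qed
  have "{v \<in> {1..n}. \<exists>g\<in>V. dist (\<phi> (\<sigma> g v)) (\<alpha> g (\<phi> v)) > \<kappa>} = (\<Union>g\<in>V. Q g)"
    by (auto simp: Q_def)
  then have "card {v \<in> {1..n}. \<exists>g\<in>V. dist (\<phi> (\<sigma> g v)) (\<alpha> g (\<phi> v)) > \<kappa>} \<le> (\<Sum>g\<in>V. card (Q g))"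
    using card_UN_le[OF \<open>finite V\<close>] by simp
  then have "real (card {v \<in> {1..n}. \<exists>g\<in>V. dist (\<phi> (\<sigma> g v)) (\<alpha> g (\<phi> v)) > \<kappa>}) * \<kappa>\<^sup>2
      \<le> real (\<Sum>g\<in>V. card (Q g)) * \<kappa>\<^sup>2"
    by (intro mult_right_mono) (simp_all only: of_nat_le_iff zero_le_power2)
  also have "\<dots> = (\<Sum>g\<in>V. real (card (Q g)) * \<kappa>\<^sup>2)" by (simp add: sum_distrib_right)
  also have "\<dots> \<le> (\<Sum>g\<in>V. \<delta>\<^sup>2 * real n)" by (rule sum_mono) (rule Q)
  finally show ?thesis by simp
qed

text \<open>Converse to the Chebyshev bound. Only vertices in \<open>P\<close> or in its preimage
  \<open>Q\<close> under \<open>\<sigma> s\<close> can contribute more than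
  \<open>(\<delta> / 2)\<^sup>2\<close>. As \<open>\<sigma> s\<close> is a permutation,
  \<open>Q\<close> is no larger than \<open>P\<close>, so the two sets add at most half of
  \<open>\<delta>\<^sup>2 * real n\<close> to the quarter coming from the other vertices.\<close>

lemma MapI_outside_small_set:
  assumes \<psi>: "\<psi> \<in> {1..n} \<rightarrow> X" and "n > 0" "\<delta> > 0"
    and perm: "\<And>s. s \<in> F \<Longrightarrow> \<sigma> s permutes {1..n}"
    and act: "\<And>s u. s \<in> F \<Longrightarrow> u \<in> X \<Longrightarrow> \<alpha> s u \<in> X"
    and M: "\<And>u w. u \<in> X \<Longrightarrow> w \<in> X \<Longrightarrow> dist u w \<le> M"
    and P: "P \<subseteq> {1..n}" "4 * M\<^sup>2 * real (card P) \<le> \<delta>\<^sup>2 * real n"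
    and near: "\<And>s v. \<lbrakk>s \<in> F; v \<in> {1..n}; v \<notin> P; \<sigma> s v \<notin> P\<rbrakk> \<Longrightarrow> dist (\<psi> (\<sigma> s v)) (\<alpha> s (\<psi> v)) \<le> \<delta> / 2"
  shows "\<psi> \<in> Map X \<alpha> F \<delta> n \<sigma>"
proof -
  have "sqrt (1 / real n * (\<Sum>v=1..n. (dist (\<psi> (\<sigma> s v)) (\<alpha> s (\<psi> v)))\<^sup>2)) \<le> \<delta>" if s: "s \<in> F" for s
  proof -
    define f where "f v = (dist (\<psi> (\<sigma> s v)) (\<alpha> s (\<psi> v)))\<^sup>2" for v
    define Q where "Q = {v \<in> {1..n}. \<sigma> s v \<in> P}"
    have finP: "finite P" using P(1) by (rule finite_subset) simp
    have "card Q \<le> card P"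
      using permutes_inj_on[OF perm[OF s]] finP by (intro card_inj_on_le[of "\<sigma> s"]) (auto simp: Q_def)
    have "f v \<le> (\<delta> / 2)\<^sup>2 + (if v \<in> P then M\<^sup>2 else 0) + (if v \<in> Q then M\<^sup>2 else 0)"
      if v: "v \<in> {1..n}" for v
    proof (cases "v \<in> P \<or> v \<in> Q")
      case True
      have "\<sigma> s v \<in> {1..n}" using permutes_in_image[OF perm[OF s]] v by blast
      then have "dist (\<psi> (\<sigma> s v)) (\<alpha> s (\<psi> v)) \<le> M" using \<psi> v by (intro M act s) auto
      then have "f v \<le> M\<^sup>2" unfolding f_def by (intro power_mono) auto
      moreover have "0 \<le> M\<^sup>2" "0 \<le> (\<delta> / 2)\<^sup>2" by simp_all
      ultimately show ?thesis using True
        by (cases "v \<in> P"; cases "v \<in> Q"; simp only: if_True if_False; linarith)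
    next
      case False
      then have "f v \<le> (\<delta> / 2)\<^sup>2" unfolding f_def
        using v by (intro power_mono near[OF s v]) (auto simp: Q_def)
      with False show ?thesis by simp
    qed
    then have "sum f {1..n} \<le> (\<Sum>v=1..n. (\<delta> / 2)\<^sup>2 + (if v \<in> P then M\<^sup>2 else 0) + (if v \<in> Q then M\<^sup>2 else 0))"
      by (rule sum_mono)
    also have "\<dots> = real n * (\<delta> / 2)\<^sup>2 + real (card P) * M\<^sup>2 + real (card Q) * M\<^sup>2"
    proof -
      have "{1..n} \<inter> P = P" "{1..n} \<inter> Q = Q" using P(1) by (auto simp: Q_def)
      then show ?thesis by (simp add: sum.distrib flip: sum.inter_restrict)
    qed
    also have "\<dots> \<le> real n * (\<delta> / 2)\<^sup>2 + real (card P) * M\<^sup>2 + real (card P) * M\<^sup>2"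
      using \<open>card Q \<le> card P\<close> by (intro add_left_mono mult_right_mono) auto
    also have "\<dots> \<le> \<delta>\<^sup>2 * real n"
    proof -
      have "4 * (real n * (\<delta> / 2)\<^sup>2 + real (card P) * M\<^sup>2 + real (card P) * M\<^sup>2)
          = \<delta>\<^sup>2 * real n + 2 * (4 * M\<^sup>2 * real (card P))"
        by (simp add: power_divide)
      moreover have "0 \<le> \<delta>\<^sup>2 * real n" by simp
      moreover have "x \<le> D" if "4 * x = D + 2 * K" "0 \<le> D" "K \<le> D" for x D K :: real
        using that by linarith
      ultimately show ?thesis using P(2) by blast
    qed
    finally have "1 / real n * sum f {1..n} \<le> \<delta>\<^sup>2" using \<open>n > 0\<close> by (simp add: field_simps)
    then have "sqrt (1 / real n * sum f {1..n}) \<le> \<delta>" using \<open>\<delta> > 0\<close> by (intro real_le_lsqrt) (auto simp: f_def sum_nonneg)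
    then show ?thesis by (simp add: f_def)
  qed
  then show ?thesis using \<psi> by (auto simp: Map_def)
qed

section \<open>Expansive actions on compact spaces\<close>

locale compact_action = group_action G X \<alpha>
  for G (structure) and X :: "'x::metric_space set" and \<alpha> :: "'g \<Rightarrow> 'x \<Rightarrow> 'x" +
  assumes compact_space: "compact X"
    and continuous_action: "g \<in> carrier G \<Longrightarrow> continuous_on X (\<alpha> g)"
begin

lemma group_G: "group G"
  using group_hom by (simp add: group_hom_def)

lemma action_closed: "g \<in> carrier G \<Longrightarrow> u \<in> X \<Longrightarrow> \<alpha> g u \<in> X"
  using element_image by blast

lemma action_one: "u \<in> X \<Longrightarrow> \<alpha> \<one> u = u"
  using id_eq_one by (metis restrict_apply)

text \<open>Compactness bounds the distances, so the real supremum is a genuine one;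
  \<open>e \<ge> 0\<close> takes care of empty \<open>K\<close>, where \<open>dist_on\<close> is
  0.\<close>

lemma dist_on_le_iff:
  assumes "K \<subseteq> carrier G" "u \<in> X" "w \<in> X" "e \<ge> 0"
  shows "dist_on \<alpha> K u w \<le> e \<longleftrightarrow> (\<forall>g\<in>K. dist (\<alpha> g u) (\<alpha> g w) \<le> e)"
proof (cases "K = {}")
  case False
  obtain M where M: "\<And>a b. a \<in> X \<Longrightarrow> b \<in> X \<Longrightarrow> dist a b \<le> M"
    using compact_imp_bounded[OF compact_space] unfolding bounded_two_points by blast
  have "bdd_above ((\<lambda>g. dist (\<alpha> g u) (\<alpha> g w)) ` K)"
    by (rule bdd_aboveI[where M = M]) (use assms M action_closed in auto)
  with False show ?thesis by (simp add: dist_on_def cSUP_le_iff)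
qed (use assms in \<open>simp add: dist_on_def\<close>)

text \<open>The pairs at distance at least \<eta> form a compact set \<open>K\<close>, and the pairs
  that \<open>g\<close> does not separate beyond \<open>c\<close> a closed set \<open>L g\<close>.
  Expansivity says that no pair of \<open>K\<close> lies in all \<open>L g\<close>; by the finite
  intersection property finitely many \<open>g\<close> already exclude all of
  \<open>K\<close>.\<close>

lemma expansive_uniform:
  assumes exp: "\<And>u w. \<lbrakk>u \<in> X; w \<in> X; u \<noteq> w\<rbrakk> \<Longrightarrow> \<exists>g\<in>carrier G. dist (\<alpha> g u) (\<alpha> g w) > c"
    and "\<eta> > 0"
  obtains C where "finite C" "C \<subseteq> carrier G"
    "\<And>u w. \<lbrakk>u \<in> X; w \<in> X; \<And>g. g \<in> C \<Longrightarrow> dist (\<alpha> g u) (\<alpha> g w) \<le> c\<rbrakk> \<Longrightarrow> dist u w < \<eta>"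
proof -
  define K where "K = (X \<times> X) \<inter> (\<lambda>p. dist (fst p) (snd p)) -` {\<eta>..}"
  define L where "L g = (X \<times> X) \<inter> (\<lambda>p. dist (\<alpha> g (fst p)) (\<alpha> g (snd p))) -` {..c}" for g
  have cXX: "compact (X \<times> X)" using compact_space by (rule compact_Times) (rule compact_space)
  have "closed K" unfolding K_def
    by (intro continuous_closed_preimage continuous_intros compact_imp_closed cXX)
  then have "compact K"
    using compact_Int_closed[OF cXX, of K] by (simp add: K_def Int_absorb1)
  moreover have "closed (L g)" if "g \<in> carrier G" for g
  proof -
    have "continuous_on (X \<times> X) (\<lambda>p. \<alpha> g (fst p))" "continuous_on (X \<times> X) (\<lambda>p. \<alpha> g (snd p))"
      by (rule continuous_on_compose2[OF continuous_action[OF that]]; force intro: continuous_intros)+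
    then show ?thesis unfolding L_def
      by (intro continuous_closed_preimage continuous_intros compact_imp_closed cXX)
  qed
  moreover have "K \<inter> (\<Inter>g\<in>carrier G. L g) = {}"
  proof -
    have False if "p \<in> K" "\<forall>g\<in>carrier G. p \<in> L g" for p
      using that exp[of "fst p" "snd p"] \<open>\<eta> > 0\<close> by (fastforce simp: K_def L_def)
    then show ?thesis by blast
  qed
  ultimately obtain C where C: "finite C" "C \<subseteq> carrier G" "K \<inter> (\<Inter>g\<in>C. L g) = {}"
    using compact_imp_fip_image[of K "carrier G" L] by blast
  show ?thesis
  proof (rule that[OF C(1,2)])
    fix u w assume "u \<in> X" "w \<in> X" and "\<And>g. g \<in> C \<Longrightarrow> dist (\<alpha> g u) (\<alpha> g w) \<le> c"
    then have "(u, w) \<in> (\<Inter>g\<in>C. L g)" by (auto simp: L_def)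
    with C(3) have "(u, w) \<notin> K" by blast
    with \<open>u \<in> X\<close> \<open>w \<in> X\<close> show "dist u w < \<eta>" by (auto simp: K_def)
  qed
qed

end

section \<open>Modification of orbits at separated sites\<close>

text \<open>A site is an element \<open>h\<close> at which an orbit is made to follow
  \<open>x'\<close>: position \<open>b \<otimes> h\<close> copies \<open>\<alpha> b x'\<close> for
  \<open>b\<close> in \<open>B\<close>, and large changes are confined to the translate
  \<open>A h\<close>. Testing with \<open>C\<close> at scale \<open>c\<close> certifies distance
  \<eta>. As \<open>E\<close> contains all \<open>inv d \<otimes> a\<close> with \<open>d\<close> in
  \<open>C\<close> and \<open>a\<close> in \<open>A\<close>, changes outside \<open>E h\<close> are
  at most \<eta>. By \<open>tolerance\<close>, the error of a whole series of modifications still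
  passes the test with \<open>C\<close>.\<close>

locale modification_setting = compact_action G X \<alpha>
  for G (structure) and X :: "'x::metric_space set" and \<alpha> :: "'g \<Rightarrow> 'x \<Rightarrow> 'x" +
  fixes c \<epsilon> \<eta> \<delta> :: real and A B C E :: "'g set" and x' :: 'x
  assumes memory: "memory_set G X \<alpha> \<epsilon> \<delta> A B"
    and nonneg: "\<epsilon> \<ge> 0" "\<eta> \<ge> 0" "\<delta> \<ge> 0"
    and tolerance: "\<epsilon> + 2 * \<eta> \<le> c"
    and E_carrier: "E \<subseteq> carrier G"
    and C_carrier: "C \<subseteq> carrier G"
    and expansive_on_C: "\<lbrakk>u \<in> X; w \<in> X; \<And>g. g \<in> C \<Longrightarrow> dist (\<alpha> g u) (\<alpha> g w) \<le> c\<rbrakk> \<Longrightarrow> dist u w \<le> \<eta>"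
    and B_subset_E: "B \<subseteq> E"
    and C_A_subset_E: "\<lbrakk>g \<in> carrier G; d \<in> C; d \<otimes> g \<in> A\<rbrakk> \<Longrightarrow> g \<in> E"
    and x'_in: "x' \<in> X"
begin

interpretation group G by (rule group_G)

lemma A_subset_B: "A \<subseteq> B" and B_carrier: "B \<subseteq> carrier G"
  using memory by (auto simp: memory_set_def)

text \<open>Equivalently, the translates \<open>E h\<close> of the sites \<open>h\<close> are
  pairwise disjoint: \<open>g \<otimes> inv h \<in> E\<close> says that \<open>g\<close> lies in
  \<open>E h\<close>.\<close>

definition separated :: "'g set \<Rightarrow> bool" where
  "separated S \<longleftrightarrow> S \<subseteq> carrier G \<and>
     (\<forall>h\<in>S. \<forall>h'\<in>S. \<forall>g\<in>carrier G. g \<otimes> inv h \<in> E \<longrightarrow> g \<otimes> inv h' \<in> E \<longrightarrow> h = h')"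

text \<open>If \<open>g\<close> avoids every \<open>E h\<close>, then \<open>d \<otimes> g\<close>
  avoids every \<open>A h\<close> for \<open>d\<close> in \<open>C\<close>. The crude bound
  \<open>c\<close> therefore holds at all these positions, and expansivity improves it to \<eta> at
  \<open>g\<close>.\<close>

lemma decay:
  assumes "u \<in> X" "w \<in> X" "S \<subseteq> carrier G"
    and close: "\<And>g. \<lbrakk>g \<in> carrier G; \<And>h. h \<in> S \<Longrightarrow> g \<otimes> inv h \<notin> A\<rbrakk> \<Longrightarrow> dist (\<alpha> g u) (\<alpha> g w) \<le> c"
    and g: "g \<in> carrier G" "\<And>h. h \<in> S \<Longrightarrow> g \<otimes> inv h \<notin> E"
  shows "dist (\<alpha> g u) (\<alpha> g w) \<le> \<eta>"
proof (rule expansive_on_C)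
  fix d assume "d \<in> C"
  then have d: "d \<in> carrier G" using C_carrier by blast
  have "d \<otimes> g \<otimes> inv h \<notin> A" if "h \<in> S" for h
  proof -
    have "h \<in> carrier G" using that assms by blast
    then have "d \<otimes> g \<otimes> inv h = d \<otimes> (g \<otimes> inv h)" and "g \<otimes> inv h \<in> carrier G"
      using d g by (auto simp: m_assoc)
    then show ?thesis using C_A_subset_E[OF _ \<open>d \<in> C\<close>] g(2)[OF that] by metis
  qed
  then have "dist (\<alpha> (d \<otimes> g) u) (\<alpha> (d \<otimes> g) w) \<le> c"
    using d g by (intro close) auto
  then show "dist (\<alpha> d (\<alpha> g u)) (\<alpha> d (\<alpha> g w)) \<le> c"
    using d g assms by (simp add: composition_rule)
qed (use assms action_closed in auto)

text \<open>The memory set condition is applied to \<open>x'\<close> and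
  \<open>\<alpha> h u\<close>, that is, with the site moved to the identity; the resulting point is
  carried back by \<open>inv h\<close>.\<close>

lemma single_modification:
  assumes "u \<in> X" "h \<in> carrier G" "\<And>b. b \<in> B - A \<Longrightarrow> dist (\<alpha> b x') (\<alpha> (b \<otimes> h) u) \<le> \<delta>"
  shows "\<exists>w\<in>X. (\<forall>b\<in>B. dist (\<alpha> b x') (\<alpha> (b \<otimes> h) w) \<le> \<epsilon>) \<and>
    (\<forall>g\<in>carrier G. g \<otimes> inv h \<notin> A \<longrightarrow> dist (\<alpha> g u) (\<alpha> g w) \<le> \<epsilon>)"
proof -
  have hu: "\<alpha> h u \<in> X" using assms action_closed by blast
  have BA: "B - A \<subseteq> carrier G" using B_carrier by blast
  have "dist_on \<alpha> (B - A) x' (\<alpha> h u) \<le> \<delta>"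
    unfolding dist_on_le_iff[OF BA x'_in hu nonneg(3)]
  proof
    fix b assume b: "b \<in> B - A"
    then show "dist (\<alpha> b x') (\<alpha> b (\<alpha> h u)) \<le> \<delta>"
      using assms(3)[OF b] assms(1,2) BA by (simp add: composition_rule subset_iff)
  qed
  then obtain z where z: "z \<in> X" "dist_on \<alpha> B x' z \<le> \<epsilon>" "dist_on \<alpha> (carrier G - A) (\<alpha> h u) z \<le> \<epsilon>"
    using memory x'_in hu unfolding memory_set_def by blast
  define w where "w = \<alpha> (inv h) z"
  have w: "w \<in> X" using z assms by (simp add: w_def action_closed)
  have hw: "\<alpha> h w = z"
    using z assms unfolding w_def
    by (metis action_one composition_rule inv_closed r_inv)
  show ?thesis
  proof (intro bexI[OF _ w] conjI ballI impI)
    fix b assume "b \<in> B"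
    with z(2) have "dist (\<alpha> b x') (\<alpha> b z) \<le> \<epsilon>"
      by (simp add: dist_on_le_iff[OF B_carrier x'_in z(1) nonneg(1)])
    then show "dist (\<alpha> b x') (\<alpha> (b \<otimes> h) w) \<le> \<epsilon>"
      using \<open>b \<in> B\<close> B_carrier assms(2) w hw by (simp add: composition_rule subset_iff)
  next
    fix g assume g: "g \<in> carrier G" "g \<otimes> inv h \<notin> A"
    then have "dist (\<alpha> (g \<otimes> inv h) (\<alpha> h u)) (\<alpha> (g \<otimes> inv h) (\<alpha> h w)) \<le> \<epsilon>"
      using z(3) dist_on_le_iff[OF _ hu z(1) nonneg(1), of "carrier G - A"] assms(2) hw by auto
    moreover have "\<alpha> (g \<otimes> inv h) (\<alpha> h v) = \<alpha> g v" if "v \<in> X" for v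
      using that g assms(2) by (simp flip: composition_rule add: m_assoc)
    ultimately show "dist (\<alpha> g u) (\<alpha> g w) \<le> \<epsilon>"
      using assms(1) w by simp
  qed
qed

text \<open>Successive modifications at separated sites do not accumulate errors: an element \<open>g\<close> is near
  at most one site, and by \<open>decay\<close> the blocks of modifications before and after that one each
  contribute at most \<open>\<eta>\<close>.\<close>

lemma modification_chain:
  fixes z :: "nat \<Rightarrow> 'x" and h :: "nat \<Rightarrow> 'g"
  assumes zX: "\<And>i. i \<le> N \<Longrightarrow> z i \<in> X"
    and inj: "inj_on h {..<N}" and sep: "separated (h ` {..<N})"
    and step: "\<And>i g. \<lbrakk>i < N; g \<in> carrier G; g \<otimes> inv h i \<notin> A\<rbrakk> \<Longrightarrow> dist (\<alpha> g (z i)) (\<alpha> g (z (Suc i))) \<le> \<epsilon>"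
    and "i \<le> j" "j \<le> N" "g \<in> carrier G" "\<And>l. i \<le> l \<Longrightarrow> l < j \<Longrightarrow> g \<otimes> inv h l \<notin> A"
  shows "dist (\<alpha> g (z i)) (\<alpha> g (z j)) \<le> \<epsilon> + 2 * \<eta>"
  using assms(5-8)
proof (induction "j - i" arbitrary: i j g rule: less_induct)
  case less
  have hc: "h l \<in> carrier G" if "l < N" for l using sep that by (auto simp: separated_def)
  \<comment> \<open>A strictly shorter block obeys the bound \<open>\<epsilon> + 2 * \<eta>\<close>
    off the translates of \<open>A\<close> by induction. This is at most \<open>c\<close>, so
    \<open>decay\<close> applies to the block.\<close>
  have decay': "dist (\<alpha> g (z p)) (\<alpha> g (z q)) \<le> \<eta>"
    if "q - p < j - i" "p \<le> q" "q \<le> N" "\<And>l. p \<le> l \<Longrightarrow> l < q \<Longrightarrow> g \<otimes> inv h l \<notin> E" for p q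
  proof (rule decay[where S = "h ` {p..<q}"])
    fix g' assume g': "g' \<in> carrier G" "\<And>h'. h' \<in> h ` {p..<q} \<Longrightarrow> g' \<otimes> inv h' \<notin> A"
    have "dist (\<alpha> g' (z p)) (\<alpha> g' (z q)) \<le> \<epsilon> + 2 * \<eta>"
      by (rule less.hyps[OF that(1-3)]) (use g' in auto)
    then show "dist (\<alpha> g' (z p)) (\<alpha> g' (z q)) \<le> c" using tolerance by simp
  qed (use that zX hc less.prems in auto)
  show ?case
  proof (cases "i = j")
    case True
    then show ?thesis using nonneg by simp
  next
    case False
    \<comment> \<open>By separation \<open>g\<close> lies in at most one translate of
      \<open>E\<close>. If it lies in none, any index serves as \<open>l\<close>, for instance
      \<open>i\<close>.\<close>
    have ex: "\<exists>l\<in>{i..<j}. \<forall>m\<in>{i..<j}. m \<noteq> l \<longrightarrow> g \<otimes> inv h m \<notin> E"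
    proof (cases "\<exists>l\<in>{i..<j}. g \<otimes> inv h l \<in> E")
      case True
      then obtain l where l: "l \<in> {i..<j}" "g \<otimes> inv h l \<in> E" by blast
      have "m = l" if "m \<in> {i..<j}" "g \<otimes> inv h m \<in> E" for m
      proof -
        have "h m = h l" using sep l that less.prems unfolding separated_def by force
        then show ?thesis using inj l that less.prems by (auto simp: inj_on_def)
      qed
      with l show ?thesis by blast
    next
      case False
      then show ?thesis using \<open>i \<noteq> j\<close> \<open>i \<le> j\<close> by (intro bexI[of _ i]) auto
    qed
    then obtain l where l: "i \<le> l" "l < j" and far: "\<And>m. i \<le> m \<Longrightarrow> m < j \<Longrightarrow> m \<noteq> l \<Longrightarrow> g \<otimes> inv h m \<notin> E"
      by auto
    have "dist (\<alpha> g (z i)) (\<alpha> g (z l)) \<le> \<eta>"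
      by (rule decay') (use l far less.prems in auto)
    moreover have "dist (\<alpha> g (z l)) (\<alpha> g (z (Suc l))) \<le> \<epsilon>"
      using l less.prems by (intro step) auto
    moreover have "dist (\<alpha> g (z (Suc l))) (\<alpha> g (z j)) \<le> \<eta>"
      by (rule decay') (use l far less.prems in auto)
    ultimately show ?thesis
      using dist_triangle[of "\<alpha> g (z i)" "\<alpha> g (z j)" "\<alpha> g (z l)"]
        dist_triangle[of "\<alpha> g (z l)" "\<alpha> g (z j)" "\<alpha> g (z (Suc l))"] by linarith
  qed
qed

text \<open>The sites are treated one after another. Position \<open>b \<otimes> h\<close> lies in
  \<open>E h\<close>, hence in no other translate of \<open>E\<close>, so the modifications made
  before the turn of \<open>h\<close> shift it by at most \<eta> in total; the slack \<eta> in
  \<open>pre\<close> absorbs this. The later modifications again cost at most \<eta>, whence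
  \<open>\<epsilon> + \<eta>\<close> at the sites.\<close>

lemma modification:
  assumes "finite S" and sep: "separated S" and y: "y \<in> X"
    and pre: "\<And>h b. \<lbrakk>h \<in> S; b \<in> B - A\<rbrakk> \<Longrightarrow> dist (\<alpha> b x') (\<alpha> (b \<otimes> h) y) + \<eta> \<le> \<delta>"
  obtains z where "z \<in> X"
    "\<And>h b. \<lbrakk>h \<in> S; b \<in> B\<rbrakk> \<Longrightarrow> dist (\<alpha> b x') (\<alpha> (b \<otimes> h) z) \<le> \<epsilon> + \<eta>"
    "\<And>g. \<lbrakk>g \<in> carrier G; \<And>h. h \<in> S \<Longrightarrow> g \<otimes> inv h \<notin> A\<rbrakk> \<Longrightarrow> dist (\<alpha> g y) (\<alpha> g z) \<le> \<epsilon> + 2 * \<eta>"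
    "\<And>g. \<lbrakk>g \<in> carrier G; \<And>h. h \<in> S \<Longrightarrow> g \<otimes> inv h \<notin> E\<rbrakk> \<Longrightarrow> dist (\<alpha> g y) (\<alpha> g z) \<le> \<eta>"
proof -
  define N where "N = card S"
  obtain h where "bij_betw h {..<N} S"
    using ex_bij_betw_nat_finite[OF \<open>finite S\<close>] by (auto simp: N_def lessThan_atLeast0)
  then have inj: "inj_on h {..<N}" and img: "h ` {..<N} = S"
    by (auto simp: bij_betw_def)
  have hS: "h l \<in> S" if "l < N" for l using img that by auto
  have hc: "h l \<in> carrier G" if "l < N" for l using hS[OF that] sep by (auto simp: separated_def)
  have off: "b \<otimes> h l \<otimes> inv h m \<notin> E" if "b \<in> B" "l < N" "m < N" "l \<noteq> m" for b l m
  proof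
    assume *: "b \<otimes> h l \<otimes> inv h m \<in> E"
    have "b \<otimes> h l \<otimes> inv h l = b" using that B_carrier hc by (simp add: m_assoc subset_iff)
    then have "h l = h m"
      using * sep hS that B_carrier B_subset_E hc unfolding separated_def
      by (metis m_closed subset_iff)
    then show False using inj that by (auto simp: inj_on_def)
  qed
  define good where "good l u w \<longleftrightarrow> w \<in> X \<and> (\<forall>b\<in>B. dist (\<alpha> b x') (\<alpha> (b \<otimes> h l) w) \<le> \<epsilon>) \<and>
    (\<forall>g\<in>carrier G. g \<otimes> inv h l \<notin> A \<longrightarrow> dist (\<alpha> g u) (\<alpha> g w) \<le> \<epsilon>)" for l u w
  define z where "z = rec_nat y (\<lambda>l u. SOME w. good l u w)"
  have z0: "z 0 = y" and zS: "z (Suc l) = (SOME w. good l (z l) w)" for l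
    by (auto simp: z_def)
  \<comment> \<open>Both chain bounds are stated for a prefix of length \<open>m\<close>. That the
    chosen points are good is itself proved by induction on \<open>m\<close>, and that induction
    uses the bounds for the steps already made.\<close>
  have chain: "dist (\<alpha> g (z i)) (\<alpha> g (z j)) \<le> \<epsilon> + 2 * \<eta>"
    if "m \<le> N" and Z: "z 0 \<in> X" "\<And>l. l < m \<Longrightarrow> good l (z l) (z (Suc l))"
      and ij: "i \<le> j" "j \<le> m" "g \<in> carrier G" "\<And>l. i \<le> l \<Longrightarrow> l < j \<Longrightarrow> g \<otimes> inv h l \<notin> A"
    for m i j g
  proof (rule modification_chain[where N = m and h = h])
    show "z l \<in> X" if "l \<le> m" for l
      using Z that by (cases l) (auto simp: good_def)
    show "inj_on h {..<m}" using inj \<open>m \<le> N\<close> by (auto simp: inj_on_def)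
    show "separated (h ` {..<m})"
      using sep img \<open>m \<le> N\<close> unfolding separated_def by fastforce
  qed (use ij Z in \<open>auto simp: good_def\<close>)
  have chainE: "dist (\<alpha> g (z i)) (\<alpha> g (z j)) \<le> \<eta>"
    if "m \<le> N" and Z: "z 0 \<in> X" "\<And>l. l < m \<Longrightarrow> good l (z l) (z (Suc l))"
      and ij: "i \<le> j" "j \<le> m" "g \<in> carrier G" "\<And>l. i \<le> l \<Longrightarrow> l < j \<Longrightarrow> g \<otimes> inv h l \<notin> E"
    for m i j g
  proof (rule decay[where S = "h ` {i..<j}"])
    show "z i \<in> X" "z j \<in> X"
      using Z ij by (cases i; force simp: good_def) (use Z ij in \<open>cases j; force simp: good_def\<close>)
    fix g' assume g': "g' \<in> carrier G" "\<And>h'. h' \<in> h ` {i..<j} \<Longrightarrow> g' \<otimes> inv h' \<notin> A"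
    have "dist (\<alpha> g' (z i)) (\<alpha> g' (z j)) \<le> \<epsilon> + 2 * \<eta>"
      by (rule chain[OF that(1-3) ij(1,2)]) (use g' in auto)
    then show "dist (\<alpha> g' (z i)) (\<alpha> g' (z j)) \<le> c" using tolerance by simp
  qed (use that hc in auto)
  have goods: "\<forall>l<m. good l (z l) (z (Suc l))" if "m \<le> N" for m
    using that
  proof (induction m)
    case (Suc m)
    then have IH: "\<And>l. l < m \<Longrightarrow> good l (z l) (z (Suc l))" by auto
    have zm: "z m \<in> X" using z0 y IH by (cases m) (auto simp: good_def)
    have "\<exists>w\<in>X. (\<forall>b\<in>B. dist (\<alpha> b x') (\<alpha> (b \<otimes> h m) w) \<le> \<epsilon>) \<and>
      (\<forall>g\<in>carrier G. g \<otimes> inv h m \<notin> A \<longrightarrow> dist (\<alpha> g (z m)) (\<alpha> g w) \<le> \<epsilon>)"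
    proof (rule single_modification[OF zm])
      show "h m \<in> carrier G" using hc Suc.prems by simp
      fix b assume b: "b \<in> B - A"
      have "dist (\<alpha> (b \<otimes> h m) (z 0)) (\<alpha> (b \<otimes> h m) (z m)) \<le> \<eta>"
        by (rule chainE[of m]) (use Suc.prems IH z0 y b B_carrier hc off in auto)
      then show "dist (\<alpha> b x') (\<alpha> (b \<otimes> h m) (z m)) \<le> \<delta>"
        using pre[OF hS b, of m] Suc.prems z0
          dist_triangle[of "\<alpha> b x'" "\<alpha> (b \<otimes> h m) (z m)" "\<alpha> (b \<otimes> h m) y"] by force
    qed
    then have "\<exists>w. good m (z m) w" unfolding good_def by blast
    then have "good m (z m) (z (Suc m))" unfolding zS by (rule someI_ex)
    with IH show ?case by (auto simp: less_Suc_eq)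
  qed simp
  then have goodN: "\<And>l. l < N \<Longrightarrow> good l (z l) (z (Suc l))" by blast
  have z0X: "z 0 \<in> X" using z0 y by simp
  show ?thesis
  proof (rule that[of "z N"])
    show "z N \<in> X" using z0X goodN by (cases N) (auto simp: good_def)
  next
    fix h' b assume "h' \<in> S" and b: "b \<in> B"
    then obtain l where l: "l < N" "h' = h l" using img by auto
    have "dist (\<alpha> b x') (\<alpha> (b \<otimes> h l) (z (Suc l))) \<le> \<epsilon>"
      using goodN[OF l(1)] b by (simp add: good_def)
    moreover have "dist (\<alpha> (b \<otimes> h l) (z (Suc l))) (\<alpha> (b \<otimes> h l) (z N)) \<le> \<eta>"
      by (rule chainE[of N]) (use goodN z0X l b B_carrier hc off in auto)
    ultimately show "dist (\<alpha> b x') (\<alpha> (b \<otimes> h') (z N)) \<le> \<epsilon> + \<eta>"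
      using l dist_triangle[of "\<alpha> b x'" "\<alpha> (b \<otimes> h l) (z N)" "\<alpha> (b \<otimes> h l) (z (Suc l))"] by simp
  next
    fix g assume "g \<in> carrier G" "\<And>h. h \<in> S \<Longrightarrow> g \<otimes> inv h \<notin> A"
    then show "dist (\<alpha> g y) (\<alpha> g (z N)) \<le> \<epsilon> + 2 * \<eta>"
      unfolding z0[symmetric] by (intro chain[of N]) (use goodN z0X hS in auto)
  next
    fix g assume "g \<in> carrier G" "\<And>h. h \<in> S \<Longrightarrow> g \<otimes> inv h \<notin> E"
    then show "dist (\<alpha> g y) (\<alpha> g (z N)) \<le> \<eta>"
      unfolding z0[symmetric] by (intro chainE[of N]) (use goodN z0X hS in auto)
  qed
qed

section \<open>Modification of microstates\<close>

text \<open>For an approximately equivariant map, sites \<open>h\<close>, \<open>h'\<close> of a vertex \<open>v\<close> violate \<open>separated\<close> only if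
  \<open>h' \<otimes> inv h\<close> is one of these quotients, which moves the vertex of \<open>h\<close> to that of \<open>h'\<close>.\<close>

definition quotients :: "'g set" where
  "quotients = (\<lambda>(e, e'). inv e \<otimes> e') ` (E \<times> E)"

lemma quotientsI: "e \<in> E \<Longrightarrow> e' \<in> E \<Longrightarrow> inv e \<otimes> e' \<in> quotients"
  by (force simp: quotients_def)

text \<open>The window must contain every site that influences \<open>\<psi> v\<close> at \<open>g \<otimes> s\<close> or \<open>\<psi> (\<sigma> s v)\<close> at \<open>g\<close>,
  for \<open>g \<in> W\<close> and \<open>s \<in> F\<close>.\<close>

definition site_window :: "'g set \<Rightarrow> 'g set \<Rightarrow> 'g set" where
  "site_window F W =
     insert \<one> ((\<lambda>(a, g). inv a \<otimes> g) ` (A \<times> (W \<union> (\<lambda>(g, s). g \<otimes> s) ` (W \<times> F))))"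

text \<open>Collects the elements whose action at a good vertex must be controlled: sites and
  quotients for the separation argument, and \<open>F\<close>, \<open>W\<close> and their products
  for comparing the orbits chosen at \<open>v\<close> and at \<open>\<sigma> s v\<close>.\<close>

definition full_window :: "'g set \<Rightarrow> 'g set \<Rightarrow> 'g set" where
  "full_window F W =
     site_window F W \<union> W \<union> F \<union> quotients \<union> (\<lambda>(g, s). g \<otimes> s) ` (W \<times> F)"

lemma full_window_carrier:
  assumes "F \<subseteq> carrier G" "W \<subseteq> carrier G"
  shows "full_window F W \<subseteq> carrier G"
proof -
  have "A \<subseteq> carrier G" using A_subset_B B_carrier by blast
  then show ?thesis
    using assms E_carrier by (auto simp: full_window_def site_window_def quotients_def subset_iff)
qed

lemma finite_site_window: "finite F \<Longrightarrow> finite W \<Longrightarrow> finite (site_window F W)"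
proof -
  have "finite A" using memory A_subset_B by (auto simp: memory_set_def intro: finite_subset)
  then show "finite F \<Longrightarrow> finite W \<Longrightarrow> finite (site_window F W)"
    by (auto simp: site_window_def)
qed

text \<open>At a vertex \<open>v\<close> outside \<open>P\<close> the orbit of
  \<open>\<phi> v\<close> is modified at the sites that lead from \<open>v\<close> into
  \<open>T\<close>. For neighbouring good vertices the sites correspond under translation by
  \<open>s\<close>. So at each position in \<open>W\<close> either both chosen orbits follow
  \<open>x'\<close>, or both stay near \<phi>. Being \<open>c\<close>-close along \<open>W\<close>,
  they are \<open>r\<close>-close.\<close>

lemma approximate_modification:
  fixes \<phi> :: "nat \<Rightarrow> 'x" and \<sigma> :: "'g \<Rightarrow> nat \<Rightarrow> nat"
  assumes perm: "\<And>g. g \<in> carrier G \<Longrightarrow> \<sigma> g permutes {1..n}"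
    and W: "finite W" "W \<subseteq> carrier G"
    and W_exp: "\<And>u w. \<lbrakk>u \<in> X; w \<in> X; \<And>g. g \<in> W \<Longrightarrow> dist (\<alpha> g u) (\<alpha> g w) \<le> c\<rbrakk> \<Longrightarrow> dist u w \<le> r"
    and F: "finite F" "F \<subseteq> carrier G"
    and one: "\<one> \<in> A"
    and tol: "2 * \<epsilon> + 4 * \<eta> + 2 * \<kappa> \<le> c" "0 \<le> \<kappa>"
    and \<phi>: "\<phi> \<in> {1..n} \<rightarrow> X"
    and J: "J \<subseteq> {1..n}" "T \<subseteq> J"
    and sepJ: "\<And>a b d. \<lbrakk>a \<in> J; b \<in> J; d \<in> quotients; a \<noteq> b\<rbrakk> \<Longrightarrow> \<sigma> d a \<noteq> b"
    and sofic: "\<And>v. \<lbrakk>v \<in> {1..n}; v \<notin> P\<rbrakk> \<Longrightarrow> sofic_at G \<sigma> (full_window F W) v"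
    and equiv: "\<And>v g. \<lbrakk>v \<in> {1..n}; v \<notin> P; g \<in> full_window F W\<rbrakk> \<Longrightarrow> dist (\<phi> (\<sigma> g v)) (\<alpha> g (\<phi> v)) \<le> \<kappa>"
    and pre: "\<And>a u b. \<lbrakk>a \<in> T; u \<in> X; dist (\<phi> a) u \<le> \<kappa>; b \<in> B - A\<rbrakk> \<Longrightarrow> dist (\<alpha> b x') (\<alpha> b u) + \<eta> \<le> \<delta>"
  obtains \<psi> where "\<psi> \<in> {1..n} \<rightarrow> X"
    "\<And>a. a \<in> T \<Longrightarrow> dist x' (\<psi> a) \<le> \<epsilon> + \<eta>"
    "\<And>a. a \<in> J - T \<Longrightarrow> dist (\<phi> a) (\<psi> a) \<le> \<eta>"
    "\<And>s v. \<lbrakk>s \<in> F; v \<in> {1..n}; v \<notin> P; \<sigma> s v \<notin> P\<rbrakk> \<Longrightarrow> dist (\<psi> (\<sigma> s v)) (\<alpha> s (\<psi> v)) \<le> r"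
proof -
  define sites where "sites v = {h \<in> site_window F W. \<sigma> h v \<in> T}" for v
  have V: "full_window F W \<subseteq> carrier G" by (rule full_window_carrier[OF F(2) W(2)])
  have sw: "site_window F W \<subseteq> full_window F W" by (auto simp: full_window_def)
  have sites_V: "h \<in> full_window F W" "h \<in> carrier G" if "h \<in> sites v" for h v
    using that sw V by (auto simp: sites_def)
  have Ac: "a \<in> carrier G" if "a \<in> A" for a using that A_subset_B B_carrier by blast
  have oneE: "\<one> \<in> E" using one A_subset_B B_subset_E by blast
  have mult: "\<sigma> (g \<otimes> h) v = \<sigma> g (\<sigma> h v)"
    if "v \<in> {1..n}" "v \<notin> P" "g \<in> full_window F W" "h \<in> full_window F W" for g h v
    using sofic[OF that(1,2)] that(3,4) by (auto simp: sofic_at_def)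
  have free: "\<sigma> g v \<noteq> \<sigma> h v"
    if "v \<in> {1..n}" "v \<notin> P" "g \<in> full_window F W" "h \<in> full_window F W" "g \<noteq> h" for g h v
    using sofic[OF that(1,2)] that(3-5) by (auto simp: sofic_at_def)
  have sep: "separated (sites v)" if v: "v \<in> {1..n}" "v \<notin> P" for v
    unfolding separated_def
  proof (intro conjI ballI impI)
    show "sites v \<subseteq> carrier G" using sites_V by blast
  next
    fix h h' g assume h: "h \<in> sites v" "h' \<in> sites v" and g: "g \<in> carrier G"
      and E: "g \<otimes> inv h \<in> E" "g \<otimes> inv h' \<in> E"
    note hc = sites_V(2)[OF h(1)] sites_V(2)[OF h(2)]
    define d where "d = h' \<otimes> inv h"
    have "inv g \<otimes> (g \<otimes> inv h) = inv h"
      using hc g by (simp flip: m_assoc)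
    then have "inv (g \<otimes> inv h') \<otimes> (g \<otimes> inv h) = d"
      using hc g by (simp add: d_def inv_mult_group m_assoc)
    then have d: "d \<in> quotients" using quotientsI[OF E(2,1)] by simp
    then have "\<sigma> (d \<otimes> h) v = \<sigma> d (\<sigma> h v)"
      using sites_V(1)[OF h(1)] by (intro mult v) (auto simp: full_window_def)
    moreover have "d \<otimes> h = h'" using hc by (simp add: d_def m_assoc)
    ultimately have "\<sigma> d (\<sigma> h v) = \<sigma> h' v" by simp
    \<comment> \<open>Both vertices belong to \<open>J\<close> and a quotient maps one to the other,
      so separation of \<open>J\<close> identifies them; freeness at \<open>v\<close> then
      identifies the sites.\<close>
    then have "\<sigma> h v = \<sigma> h' v"
      using sepJ[of "\<sigma> h v" "\<sigma> h' v" d] d h J(2) by (auto simp: sites_def)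
    then show "h = h'" using free[OF v sites_V(1)[OF h(1)] sites_V(1)[OF h(2)]] by blast
  qed
  have "\<exists>z. z \<in> X \<and>
    (\<forall>h\<in>sites v. \<forall>b\<in>B. dist (\<alpha> b x') (\<alpha> (b \<otimes> h) z) \<le> \<epsilon> + \<eta>) \<and>
    (\<forall>g\<in>carrier G. (\<forall>h\<in>sites v. g \<otimes> inv h \<notin> A) \<longrightarrow> dist (\<alpha> g (\<phi> v)) (\<alpha> g z) \<le> \<epsilon> + 2 * \<eta>) \<and>
    (\<forall>g\<in>carrier G. (\<forall>h\<in>sites v. g \<otimes> inv h \<notin> E) \<longrightarrow> dist (\<alpha> g (\<phi> v)) (\<alpha> g z) \<le> \<eta>)"
    if v: "v \<in> {1..n} - P" for v
  proof (rule modification[of "sites v" "\<phi> v"])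
    show "finite (sites v)"
      using finite_site_window[OF F(1) W(1)] by (auto simp: sites_def)
    show "separated (sites v)" using sep v by blast
    show \<phi>v: "\<phi> v \<in> X" using \<phi> v by blast
    fix h b assume h: "h \<in> sites v" and b: "b \<in> B - A"
    have "dist (\<alpha> b x') (\<alpha> b (\<alpha> h (\<phi> v))) + \<eta> \<le> \<delta>"
    proof (rule pre)
      show "\<sigma> h v \<in> T" using h by (simp add: sites_def)
      show "dist (\<phi> (\<sigma> h v)) (\<alpha> h (\<phi> v)) \<le> \<kappa>" using equiv sites_V(1)[OF h] v by blast
    qed (use \<phi>v action_closed sites_V[OF h] b in auto)
    then show "dist (\<alpha> b x') (\<alpha> (b \<otimes> h) (\<phi> v)) + \<eta> \<le> \<delta>"
      using \<phi>v sites_V[OF h] b B_carrier by (simp add: composition_rule subset_iff)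
  qed blast
  then obtain zf where zf: "\<And>v. v \<in> {1..n} - P \<Longrightarrow> zf v \<in> X \<and>
    (\<forall>h\<in>sites v. \<forall>b\<in>B. dist (\<alpha> b x') (\<alpha> (b \<otimes> h) (zf v)) \<le> \<epsilon> + \<eta>) \<and>
    (\<forall>g\<in>carrier G. (\<forall>h\<in>sites v. g \<otimes> inv h \<notin> A) \<longrightarrow> dist (\<alpha> g (\<phi> v)) (\<alpha> g (zf v)) \<le> \<epsilon> + 2 * \<eta>) \<and>
    (\<forall>g\<in>carrier G. (\<forall>h\<in>sites v. g \<otimes> inv h \<notin> E) \<longrightarrow> dist (\<alpha> g (\<phi> v)) (\<alpha> g (zf v)) \<le> \<eta>)"
    by metis
  have zX: "zf v \<in> X" if "v \<in> {1..n}" "v \<notin> P" for v using zf[of v] that by blast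
  have z_site: "dist (\<alpha> b x') (\<alpha> (b \<otimes> h) (zf v)) \<le> \<epsilon> + \<eta>"
    if "v \<in> {1..n}" "v \<notin> P" "h \<in> sites v" "b \<in> B" for v h b using zf[of v] that by blast
  have z_off_A: "dist (\<alpha> g (\<phi> v)) (\<alpha> g (zf v)) \<le> \<epsilon> + 2 * \<eta>"
    if "v \<in> {1..n}" "v \<notin> P" "g \<in> carrier G" "\<And>h. h \<in> sites v \<Longrightarrow> g \<otimes> inv h \<notin> A" for v g
    using zf[of v] that by blast
  have z_off_E: "dist (\<alpha> g (\<phi> v)) (\<alpha> g (zf v)) \<le> \<eta>"
    if "v \<in> {1..n}" "v \<notin> P" "g \<in> carrier G" "\<And>h. h \<in> sites v \<Longrightarrow> g \<otimes> inv h \<notin> E" for v g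
    using zf[of v] that by blast
  \<comment> \<open>No equivariance is demanded at vertices in \<open>P\<close>; there the value
    only has to be close to the prescribed point.\<close>
  define \<psi> where "\<psi> v = (if v \<in> P then (if v \<in> T then x' else \<phi> v) else zf v)" for v
  show ?thesis
  proof (rule that[of \<psi>])
    show "\<psi> \<in> {1..n} \<rightarrow> X" using \<phi> zX x'_in by (auto simp: \<psi>_def)
  next
    fix a assume a: "a \<in> T"
    show "dist x' (\<psi> a) \<le> \<epsilon> + \<eta>"
    proof (cases "a \<in> P")
      case True
      then show ?thesis using a nonneg by (simp add: \<psi>_def)
    next
      case False
      have an: "a \<in> {1..n}" using a J by blast
      have oneW: "\<one> \<in> site_window F W" by (simp add: site_window_def)
      \<comment> \<open>Multiplicativity and injectivity show that \<open>\<sigma> \<one>\<close>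
        fixes the good vertex \<open>a\<close>. Thus \<open>\<one>\<close> is a site of
        \<open>a\<close>, and since \<open>\<one>\<close> is in \<open>A\<close>, hence in
        \<open>B\<close>, the orbit follows \<open>x'\<close> at \<open>a\<close> itself.\<close>
      then have "\<sigma> \<one> a = \<sigma> \<one> (\<sigma> \<one> a)" using mult[OF an False, of \<one> \<one>] sw by auto
      then have "\<sigma> \<one> a = a" using permutes_inj[OF perm[OF one_closed]] by (metis injD)
      then have "\<one> \<in> sites a" using oneW a by (simp add: sites_def)
      then have "dist (\<alpha> \<one> x') (\<alpha> (\<one> \<otimes> \<one>) (zf a)) \<le> \<epsilon> + \<eta>"
        using one A_subset_B by (intro z_site an False) auto
      then show ?thesis using False x'_in zX[OF an False] by (simp add: \<psi>_def action_one)
    qed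
  next
    fix a assume a: "a \<in> J - T"
    show "dist (\<phi> a) (\<psi> a) \<le> \<eta>"
    proof (cases "a \<in> P")
      case True
      then show ?thesis using a nonneg by (simp add: \<psi>_def)
    next
      case False
      have an: "a \<in> {1..n}" using a J by blast
      \<comment> \<open>A site \<open>h\<close> of \<open>a\<close> with \<open>\<one>\<close> in
        its translate \<open>E h\<close> would be a quotient carrying \<open>a\<close> to a
        different vertex of \<open>J\<close>.\<close>
      have "dist (\<alpha> \<one> (\<phi> a)) (\<alpha> \<one> (zf a)) \<le> \<eta>"
      proof (rule z_off_E[OF an False one_closed])
        fix h assume h: "h \<in> sites a"
        show "\<one> \<otimes> inv h \<notin> E"
        proof
          assume "\<one> \<otimes> inv h \<in> E"
          then have "h \<in> quotients"
            using quotientsI[of "inv h" \<one>] oneE sites_V(2)[OF h] by simp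
          moreover have "\<sigma> h a \<in> T" using h by (simp add: sites_def)
          moreover have "a \<in> J" "\<sigma> h a \<noteq> a" using a calculation(2) by auto
          ultimately show False using sepJ J(2) by (metis subsetD)
        qed
      qed
      then show ?thesis using False zX[OF an False] \<phi> an by (simp add: \<psi>_def action_one Pi_iff)
    qed
  next
    fix s v assume s: "s \<in> F" and v: "v \<in> {1..n}" "v \<notin> P" and sP: "\<sigma> s v \<notin> P"
    have sc: "s \<in> carrier G" using s F by blast
    have sv: "\<sigma> s v \<in> {1..n}" using permutes_in_image[OF perm[OF sc]] v by blast
    have sV: "s \<in> full_window F W" using s by (auto simp: full_window_def)
    have "dist (zf (\<sigma> s v)) (\<alpha> s (zf v)) \<le> r"
    proof (rule W_exp)
      fix g assume g: "g \<in> W"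
      have gc: "g \<in> carrier G" using g W by blast
      have gs: "g \<otimes> s \<in> carrier G" using gc sc by simp
      have gV: "g \<in> full_window F W" "g \<otimes> s \<in> full_window F W"
        using g s by (auto simp: full_window_def intro!: image_eqI)
      have bound: "2 * (\<epsilon> + \<eta>) \<le> c" using tol nonneg by argo
      have "dist (\<alpha> g (zf (\<sigma> s v))) (\<alpha> (g \<otimes> s) (zf v)) \<le> c"
      \<comment> \<open>The first case is a shared site: \<open>h\<close> seen from
        \<open>\<sigma> s v\<close> and \<open>h \<otimes> s\<close> seen from \<open>v\<close> lead
        to the same vertex of \<open>T\<close>, and both orbits are close to
        \<open>\<alpha> b x'\<close>.\<close>
      proof (cases "\<exists>h b. b \<in> A \<and> h \<in> sites (\<sigma> s v) \<and> h \<otimes> s \<in> sites v \<and> g = b \<otimes> h")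
        case True
        then obtain h b where hb: "b \<in> A" "h \<in> sites (\<sigma> s v)" "h \<otimes> s \<in> sites v" "g = b \<otimes> h" by blast
        have bB: "b \<in> B" using hb A_subset_B by blast
        have "dist (\<alpha> b x') (\<alpha> (b \<otimes> h) (zf (\<sigma> s v))) \<le> \<epsilon> + \<eta>" by (rule z_site[OF sv sP hb(2) bB])
        moreover have "dist (\<alpha> b x') (\<alpha> (b \<otimes> (h \<otimes> s)) (zf v)) \<le> \<epsilon> + \<eta>" by (rule z_site[OF v hb(3) bB])
        moreover have "b \<otimes> (h \<otimes> s) = g \<otimes> s" using hb Ac sites_V sc by (simp add: m_assoc)
        ultimately show ?thesis
          using bound hb(4) dist_triangle3[of "\<alpha> g (zf (\<sigma> s v))" "\<alpha> (g \<otimes> s) (zf v)" "\<alpha> b x'"] by simp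
      next
        \<comment> \<open>Now \<open>g\<close> lies in no \<open>A h\<close> for a site of
          \<open>\<sigma> s v\<close>, and \<open>g \<otimes> s\<close> in none for a site of
          \<open>v\<close>: the site window is large enough that such a site at one vertex would
          translate to a site at the other. Both orbits are then within
          \<open>\<epsilon> + 2 * \<eta>\<close> of those of \<phi>, which differ from each other by
          at most \<open>2 * \<kappa>\<close>.\<close>
        case False
        have swV: "inv b \<otimes> g \<in> site_window F W" "inv b \<otimes> (g \<otimes> s) \<in> site_window F W" if "b \<in> A" for b
          using that g s by (force simp: site_window_def)+
        have off1: "g \<otimes> inv h \<notin> A" if h: "h \<in> sites (\<sigma> s v)" for h
        proof
          assume gh: "g \<otimes> inv h \<in> A"
          note hc = sites_V(2)[OF h]
          have gb: "g = (g \<otimes> inv h) \<otimes> h" using gc hc by (simp add: m_assoc)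
          have "inv g \<otimes> (g \<otimes> s) = s"
            using gc sc by (simp flip: m_assoc)
          then have "inv (g \<otimes> inv h) \<otimes> (g \<otimes> s) = h \<otimes> s"
            using hc gc sc by (simp add: inv_mult_group m_assoc)
          then have "h \<otimes> s \<in> site_window F W"
            using swV(2)[OF gh] by simp
          moreover have "\<sigma> (h \<otimes> s) v \<in> T"
            using mult[OF v sites_V(1)[OF h] sV] h by (simp add: sites_def)
          ultimately have "h \<otimes> s \<in> sites v" by (simp add: sites_def)
          with False gh h gb show False by blast
        qed
        have off2: "(g \<otimes> s) \<otimes> inv h \<notin> A" if h: "h \<in> sites v" for h
        proof
          assume gh: "(g \<otimes> s) \<otimes> inv h \<in> A"
          note hc = sites_V(2)[OF h]
          define h' where "h' = h \<otimes> inv s"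
          have h': "h' \<in> carrier G" "h' \<otimes> s = h" using hc sc by (auto simp: h'_def m_assoc)
          have gb: "g = ((g \<otimes> s) \<otimes> inv h) \<otimes> h'"
          proof -
            have "inv h \<otimes> (h \<otimes> inv s) = inv s"
              using hc sc by (simp flip: m_assoc)
            then show ?thesis using hc gc sc by (simp add: h'_def m_assoc)
          qed
          have "inv ((g \<otimes> s) \<otimes> inv h) \<otimes> g = h'"
            using gb Ac[OF gh] h' gc by (metis inv_solve_left m_closed)
          then have "h' \<in> site_window F W" using swV(1)[OF gh] by simp
          moreover have "\<sigma> h' (\<sigma> s v) \<in> T"
            using mult[OF v _ sV, of h'] calculation sw h h' by (auto simp: sites_def)
          ultimately have "h' \<in> sites (\<sigma> s v)" by (simp add: sites_def)
          with False gh h h' gb show False by blast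
        qed
        have "dist (\<alpha> g (\<phi> (\<sigma> s v))) (\<alpha> g (zf (\<sigma> s v))) \<le> \<epsilon> + 2 * \<eta>"
          by (rule z_off_A[OF sv sP gc off1])
        moreover have "dist (\<alpha> (g \<otimes> s) (\<phi> v)) (\<alpha> (g \<otimes> s) (zf v)) \<le> \<epsilon> + 2 * \<eta>"
          by (rule z_off_A[OF v gs off2])
        moreover have "dist (\<phi> (\<sigma> g (\<sigma> s v))) (\<alpha> g (\<phi> (\<sigma> s v))) \<le> \<kappa>"
          by (rule equiv[OF sv sP gV(1)])
        moreover have "dist (\<phi> (\<sigma> g (\<sigma> s v))) (\<alpha> (g \<otimes> s) (\<phi> v)) \<le> \<kappa>"
          using equiv[OF v gV(2)] mult[OF v gV(1) sV] by simp
        ultimately show ?thesis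
          using tol(1)
            dist_triangle3[of "\<alpha> g (zf (\<sigma> s v))" "\<alpha> (g \<otimes> s) (zf v)" "\<alpha> g (\<phi> (\<sigma> s v))"]
            dist_triangle3[of "\<alpha> g (\<phi> (\<sigma> s v))" "\<alpha> (g \<otimes> s) (\<phi> v)" "\<phi> (\<sigma> g (\<sigma> s v))"]
            dist_triangle[of "\<alpha> g (\<phi> (\<sigma> s v))" "\<alpha> (g \<otimes> s) (zf v)" "\<alpha> (g \<otimes> s) (\<phi> v)"]
          by linarith
      qed
      then show "dist (\<alpha> g (zf (\<sigma> s v))) (\<alpha> g (\<alpha> s (zf v))) \<le> c"
        using gc sc zX[OF v] by (simp add: composition_rule)
    qed (use zX v sv sP sc action_closed in auto)
    then show "dist (\<psi> (\<sigma> s v)) (\<alpha> s (\<psi> v)) \<le> r"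
      using v sP by (simp add: \<psi>_def)
  qed
qed

text \<open>The neighbourhoods \<open>U'\<close> are shrunk so that errors up to \<eta> stay inside
  \<open>U\<close>, and so that orbits starting within \<kappa> of \<open>U' k\<close> can be
  redirected to \<open>x'\<close>. Passing to a separated subset divides the density by a factor
  determined by \<open>E\<close>.\<close>

lemma independence_transfer:
  assumes sofic: "sofic_approximation G n \<sigma>"
    and exp: "\<And>u w. \<lbrakk>u \<in> X; w \<in> X; u \<noteq> w\<rbrakk> \<Longrightarrow> \<exists>g\<in>carrier G. dist (\<alpha> g u) (\<alpha> g w) > c"
    and one: "\<one> \<in> A" and "finite E"
    and tol: "2 * \<epsilon> + 4 * \<eta> + 2 * \<kappa> \<le> c" "0 < \<kappa>"
    and "1 \<le> k"
    and density: "positive_upper_independence_density G X \<alpha> n \<sigma> k U'"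
    and U'_pre: "\<And>a u b. \<lbrakk>a \<in> U' k; u \<in> X; dist a u \<le> \<kappa>; b \<in> B - A\<rbrakk> \<Longrightarrow> dist (\<alpha> b x') (\<alpha> b u) + \<eta> \<le> \<delta>"
    and U'_U: "\<And>j a u. \<lbrakk>j \<in> {1..k}; a \<in> U' j; u \<in> X; dist a u \<le> \<eta>\<rbrakk> \<Longrightarrow> u \<in> U j"
    and x'_U: "\<And>u. \<lbrakk>u \<in> X; dist x' u \<le> \<epsilon> + \<eta>\<rbrakk> \<Longrightarrow> u \<in> U (k + 1)"
  shows "positive_upper_independence_density G X \<alpha> n \<sigma> (k + 1) U"
proof -
  obtain q where "q > 0" and q: "\<And>F r. \<lbrakk>finite F; F \<subseteq> carrier G; r > 0\<rbrakk> \<Longrightarrow>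
      infinite {i. \<exists>J. independence_set X \<alpha> F r (n i) (\<sigma> i) k U' J \<and> real (card J) \<ge> q * real (n i)}"
    using density unfolding positive_upper_independence_density_def by blast
  \<comment> \<open>The loss factor of \<open>separated_subset\<close>, fixed before the window
    \<open>F\<close> and the precision \<open>r\<close> are given.\<close>
  define m where "m = 2 * card quotients + 1"
  have fq: "finite quotients" using \<open>finite E\<close> by (simp add: quotients_def)
  have qc: "quotients \<subseteq> carrier G" using E_carrier by (auto simp: quotients_def subset_iff)
  have npos: "n i > 0" for i using sofic by (simp add: sofic_approximation_def)
  have perm: "\<sigma> i g permutes {1..n i}" if "g \<in> carrier G" for i g
    using sofic that by (simp add: sofic_approximation_def)
  obtain M0 where M0: "\<And>u w. u \<in> X \<Longrightarrow> w \<in> X \<Longrightarrow> dist u w \<le> M0"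
    using compact_imp_bounded[OF compact_space] unfolding bounded_two_points by blast
  \<comment> \<open>The maximum with 1 keeps the later division by \<open>M\<^sup>2\<close>
    meaningful.\<close>
  define M where "M = max M0 1"
  have M: "M > 0" "\<And>u w. u \<in> X \<Longrightarrow> w \<in> X \<Longrightarrow> dist u w \<le> M"
    using M0 by (auto simp: M_def le_max_iff_disj)
  have "infinite {i. \<exists>J. independence_set X \<alpha> F r (n i) (\<sigma> i) (k + 1) U J \<and> real (card J) \<ge> q / m * real (n i)}"
    if F: "finite F" "F \<subseteq> carrier G" and "r > 0" for F r
  proof -
    obtain W where W: "finite W" "W \<subseteq> carrier G"
      and W_exp: "\<And>u w. \<lbrakk>u \<in> X; w \<in> X; \<And>g. g \<in> W \<Longrightarrow> dist (\<alpha> g u) (\<alpha> g w) \<le> c\<rbrakk> \<Longrightarrow> dist u w < r / 2"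
      using expansive_uniform[OF exp, of "r / 2"] \<open>r > 0\<close> by auto
    define V where "V = full_window F W"
    have V: "finite V" "V \<subseteq> carrier G"
      using finite_site_window[OF F(1) W(1)] fq F W full_window_carrier[OF F(2) W(2)]
      by (auto simp: V_def full_window_def)
    \<comment> \<open>Two bad sets, each of density at most \<beta>, must satisfy the requirement on
      \<open>P\<close> in \<open>MapI_outside_small_set\<close>:
      \<open>4 * M\<^sup>2 * (2 * \<beta>) = r\<^sup>2\<close>.\<close>
    define \<beta> where "\<beta> = r\<^sup>2 / (8 * M\<^sup>2)"
    have "\<beta> > 0" using \<open>r > 0\<close> M(1) by (simp add: \<beta>_def)
    \<comment> \<open>Chosen so that the Chebyshev bound for deviations above \<kappa> gives a bad
      set of density at most \<beta>.\<close>
    define r' where "r' = \<kappa> * sqrt (\<beta> / real (card V + 1))"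
    have "r' > 0" using \<open>\<beta> > 0\<close> tol(2) by (simp add: r'_def)
    have r'2: "r'\<^sup>2 = \<kappa>\<^sup>2 * (\<beta> / real (card V + 1))"
      using \<open>\<beta> > 0\<close> by (simp add: r'_def power_mult_distrib)
    obtain N where N: "\<And>i. i \<ge> N \<Longrightarrow>
        real (card {v \<in> {1..n i}. \<not> sofic_at G (\<sigma> i) V v}) \<le> \<beta> * real (n i)"
      using sofic_at_mostly[OF sofic V \<open>\<beta> > 0\<close>] unfolding eventually_sequentially by blast
    let ?I = "{i. \<exists>J. independence_set X \<alpha> V r' (n i) (\<sigma> i) k U' J \<and> real (card J) \<ge> q * real (n i)}"
    have "\<exists>J. independence_set X \<alpha> F r (n i) (\<sigma> i) (k + 1) U J \<and> real (card J) \<ge> q / m * real (n i)"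
      \<comment> \<open>Discarding the finitely many indices below \<open>N\<close> leaves
        infinitely many, and for these the sofic defects are small too.\<close>
      if i: "i \<in> ?I - {..<N}" for i
    proof -
      obtain J where J: "J \<subseteq> {1..n i}" "real (card J) \<ge> q * real (n i)"
        and ind: "\<And>\<omega>. \<omega> \<in> J \<rightarrow> {1..k} \<Longrightarrow> \<exists>\<phi>\<in>Map X \<alpha> V r' (n i) (\<sigma> i). \<forall>a\<in>J. \<phi> a \<in> U' (\<omega> a)"
        using i unfolding independence_set_def by blast
      have "finite J" using J(1) by (rule finite_subset) simp
      moreover have "inj_on (\<sigma> i d) J" if "d \<in> quotients" for d
        using perm qc that by (intro permutes_inj_on) blast
      ultimately obtain J' where J': "J' \<subseteq> J"
        and sepJ: "\<And>a b d. \<lbrakk>a \<in> J'; b \<in> J'; d \<in> quotients; a \<noteq> b\<rbrakk> \<Longrightarrow> \<sigma> i d a \<noteq> b"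
        and cardJ: "card J \<le> m * card J'"
        using separated_subset[of J quotients "\<sigma> i"] fq unfolding m_def by metis
      have J'n: "J' \<subseteq> {1..n i}" using J J' by blast
      have "\<exists>\<psi>\<in>Map X \<alpha> F r (n i) (\<sigma> i). \<forall>a\<in>J'. \<psi> a \<in> U (\<omega> a)" if \<omega>: "\<omega> \<in> J' \<rightarrow> {1..k+1}" for \<omega>
      proof -
        \<comment> \<open>Label \<open>k + 1\<close> becomes \<open>k\<close>, to be corrected by
          the modification. Points of \<open>J\<close> outside \<open>J'\<close> also receive
          \<open>k\<close>, an arbitrary choice since nothing is demanded of them
          afterwards.\<close>
        define \<omega>' where "\<omega>' a = (if a \<in> J' \<and> \<omega> a \<le> k then \<omega> a else k)" for a
        have "\<omega>' \<in> J \<rightarrow> {1..k}" using \<omega> \<open>1 \<le> k\<close> by (auto simp: \<omega>'_def Pi_iff)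
        then obtain \<phi> where \<phi>: "\<phi> \<in> Map X \<alpha> V r' (n i) (\<sigma> i)" and \<phi>U: "\<And>a. a \<in> J \<Longrightarrow> \<phi> a \<in> U' (\<omega>' a)"
          using ind by blast
        have \<phi>X: "\<phi> \<in> {1..n i} \<rightarrow> X" using \<phi> by (simp add: Map_def)
        define T where "T = {a \<in> J'. \<omega> a = k + 1}"
        define P1 where "P1 = {v \<in> {1..n i}. \<not> sofic_at G (\<sigma> i) V v}"
        define P2 where "P2 = {v \<in> {1..n i}. \<exists>g\<in>V. dist (\<phi> (\<sigma> i g v)) (\<alpha> g (\<phi> v)) > \<kappa>}"
        have "real (card P2) * \<kappa>\<^sup>2 \<le> real (card V) * r'\<^sup>2 * real (n i)"
          unfolding P2_def by (rule Map_chebyshev[OF \<phi> V(1) npos tol(2)])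
        also have "\<dots> = \<kappa>\<^sup>2 * (real (card V) / real (card V + 1)) * (\<beta> * real (n i))"
          unfolding r'2 by simp
        also have "\<dots> \<le> \<kappa>\<^sup>2 * 1 * (\<beta> * real (n i))"
          using \<open>\<beta> > 0\<close> by (intro mult_right_mono mult_left_mono) auto
        finally have "real (card P2) \<le> \<beta> * real (n i)" using tol(2) by (simp add: mult.commute)
        moreover have "real (card P1) \<le> \<beta> * real (n i)" unfolding P1_def using i by (intro N) auto
        moreover have "real (card (P1 \<union> P2)) \<le> real (card P1) + real (card P2)"
          using card_Un_le[of P1 P2] by linarith
        ultimately have cardP: "real (card (P1 \<union> P2)) \<le> 2 * (\<beta> * real (n i))" by linarith
        have "4 * M\<^sup>2 * real (card (P1 \<union> P2)) \<le> 4 * M\<^sup>2 * (2 * (\<beta> * real (n i)))"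
          by (rule mult_left_mono[OF cardP]) simp
        also have "\<dots> = r\<^sup>2 * real (n i)" using M(1) by (simp add: \<beta>_def)
        finally have small: "4 * M\<^sup>2 * real (card (P1 \<union> P2)) \<le> r\<^sup>2 * real (n i)" .
        obtain \<psi> where \<psi>: "\<psi> \<in> {1..n i} \<rightarrow> X"
          "\<And>a. a \<in> T \<Longrightarrow> dist x' (\<psi> a) \<le> \<epsilon> + \<eta>"
          "\<And>a. a \<in> J' - T \<Longrightarrow> dist (\<phi> a) (\<psi> a) \<le> \<eta>"
          "\<And>s v. \<lbrakk>s \<in> F; v \<in> {1..n i}; v \<notin> P1 \<union> P2; \<sigma> i s v \<notin> P1 \<union> P2\<rbrakk>
             \<Longrightarrow> dist (\<psi> (\<sigma> i s v)) (\<alpha> s (\<psi> v)) \<le> r / 2"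
        proof (rule approximate_modification[where \<phi> = \<phi> and \<sigma> = "\<sigma> i" and n = "n i" and W = W
              and F = F and J = J' and T = T and P = "P1 \<union> P2" and r = "r / 2" and \<kappa> = \<kappa>])
          show "dist u w \<le> r / 2" if "u \<in> X" "w \<in> X" "\<And>g. g \<in> W \<Longrightarrow> dist (\<alpha> g u) (\<alpha> g w) \<le> c" for u w
            using W_exp[OF that] by simp
          show "T \<subseteq> J'" by (auto simp: T_def)
          show "sofic_at G (\<sigma> i) (full_window F W) v" if "v \<in> {1..n i}" "v \<notin> P1 \<union> P2" for v
            using that by (simp add: P1_def V_def)
          show "dist (\<phi> (\<sigma> i g v)) (\<alpha> g (\<phi> v)) \<le> \<kappa>"
            if "v \<in> {1..n i}" "v \<notin> P1 \<union> P2" "g \<in> full_window F W" for v g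
            using that by (force simp: P2_def V_def)
          show "dist (\<alpha> b x') (\<alpha> b u) + \<eta> \<le> \<delta>"
            if "a \<in> T" "u \<in> X" "dist (\<phi> a) u \<le> \<kappa>" "b \<in> B - A" for a u b
          proof (rule U'_pre)
            show "\<phi> a \<in> U' k" using \<phi>U[of a] that(1) J' by (auto simp: T_def \<omega>'_def)
          qed (use that in auto)
        qed (use perm W F one tol \<phi>X J'n sepJ in auto)
        have "\<psi> \<in> Map X \<alpha> F r (n i) (\<sigma> i)"
        proof (rule MapI_outside_small_set[where M = M and P = "P1 \<union> P2"])
          show "\<psi> \<in> {1..n i} \<rightarrow> X" "n i > 0" "r > 0" by (rule \<psi>(1), rule npos, fact)
          show "4 * M\<^sup>2 * real (card (P1 \<union> P2)) \<le> r\<^sup>2 * real (n i)" by (rule small)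
          show "dist u w \<le> M" if "u \<in> X" "w \<in> X" for u w by (rule M(2)[OF that])
          show "dist (\<psi> (\<sigma> i s v)) (\<alpha> s (\<psi> v)) \<le> r / 2"
            if "s \<in> F" "v \<in> {1..n i}" "v \<notin> P1 \<union> P2" "\<sigma> i s v \<notin> P1 \<union> P2" for s v
            by (rule \<psi>(4)[OF that])
          show "P1 \<union> P2 \<subseteq> {1..n i}" by (auto simp: P1_def P2_def)
          show "\<sigma> i s permutes {1..n i}" if "s \<in> F" for s
            using F(2) that by (intro perm) blast
          show "\<alpha> s u \<in> X" if "s \<in> F" "u \<in> X" for s u
            using F(2) that by (intro action_closed) blast+
        qed
        moreover have "\<psi> a \<in> U (\<omega> a)" if a: "a \<in> J'" for a
        proof -
          have aX: "\<psi> a \<in> X" using \<psi>(1) J'n a by blast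
          have \<omega>a: "\<omega> a \<in> {1..k+1}" using \<omega> a by blast
          show ?thesis
          proof (cases "a \<in> T")
            case True
            then show ?thesis using x'_U[OF aX \<psi>(2)] by (simp add: T_def)
          next
            case False
            with a \<omega>a have "\<omega>' a = \<omega> a" "\<omega> a \<in> {1..k}" by (auto simp: T_def \<omega>'_def)
            then show ?thesis
              using U'_U[OF _ _ aX \<psi>(3)] \<phi>U[of a] J' a False by auto
          qed
        qed
        ultimately show ?thesis by blast
      qed
      then have "independence_set X \<alpha> F r (n i) (\<sigma> i) (k + 1) U J'"
        using J'n by (simp add: independence_set_def)
      moreover have "q / m * real (n i) \<le> real (card J')"
      proof -
        have "q * real (n i) \<le> real m * real (card J')"
          using J(2) cardJ by (metis of_nat_le_iff of_nat_mult order_trans)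
        then show ?thesis by (simp add: m_def field_simps)
      qed
      ultimately show ?thesis by blast
    qed
    then have "?I - {..<N} \<subseteq> {i. \<exists>J. independence_set X \<alpha> F r (n i) (\<sigma> i) (k + 1) U J \<and> real (card J) \<ge> q / m * real (n i)}"
      by blast
    moreover have "infinite (?I - {..<N})"
      using q[OF V \<open>r' > 0\<close>] by (intro Diff_infinite_finite) auto
    ultimately show ?thesis using finite_subset by blast
  qed
  moreover have "q / m > 0" using \<open>q > 0\<close> by (simp add: m_def)
  ultimately show ?thesis unfolding positive_upper_independence_density_def by blast
qed

end

section \<open>Asymptotic pairs and independence\<close>

theorem theorem6p4:
  fixes G :: "('g, 'm) monoid_scheme"
    and X :: "'x::metric_space set"
    and \<alpha> :: "'g \<Rightarrow> 'x \<Rightarrow> 'x"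
    and n :: "nat \<Rightarrow> nat"
    and \<sigma> :: "nat \<Rightarrow> 'g \<Rightarrow> nat \<Rightarrow> nat"
    and k :: nat
    and x :: "nat \<Rightarrow> 'x"
  assumes "group G" and "countable (carrier G)" and "infinite (carrier G)" and "sofic_group G"
    and "sofic_approximation G n \<sigma>"
    and "compact X"
    and "action_by_homeomorphisms G X \<alpha>"
    and "expansive G X \<alpha>"
    and "topological_Markov_property G X \<alpha>"
    and "k \<ge> 1"
    and "x \<in> {1..k+1} \<rightarrow> X"
    and "x \<in> IE_tuples G X \<alpha> n \<sigma> k"
    and "asymptotic_pair G X \<alpha> (x k) (x (k + 1))"
  shows "x \<in> IE_tuples G X \<alpha> n \<sigma> (k + 1)"
proof -
  have act: "group_action G X \<alpha>" using assms(7) by (simp add: action_by_homeomorphisms_def)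
  have cont: "continuous_on X (\<alpha> g)" if "g \<in> carrier G" for g
  proof -
    have "homeomorphic_map (top_of_set X) (top_of_set X) (\<alpha> g)"
      using assms(7) that by (simp add: action_by_homeomorphisms_def)
    from homeomorphic_imp_continuous_map[OF this] show ?thesis
      by simp
  qed
  interpret compact_action G X \<alpha>
    using act cont assms(6) by (simp add: compact_action_def compact_action_axioms_def)
  interpret group G by (rule assms(1))
  have xk: "x k \<in> X" and xk1: "x (k + 1) \<in> X" using assms(10,11) by (auto simp: Pi_iff)
  obtain c where "c > 0"
    and exp: "\<And>u w. \<lbrakk>u \<in> X; w \<in> X; u \<noteq> w\<rbrakk> \<Longrightarrow> \<exists>g\<in>carrier G. dist (\<alpha> g u) (\<alpha> g w) > c"
    using assms(8) unfolding expansive_def by blast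
  have "positive_upper_independence_density G X \<alpha> n \<sigma> (k + 1) U"
    if U: "\<forall>j\<in>{1..k+1}. U j \<subseteq> X \<and> (\<exists>V. openin (top_of_set X) V \<and> x j \<in> V \<and> V \<subseteq> U j)" for U
  proof -
    have "\<exists>e>0. \<forall>j\<in>{1..k+1}. \<forall>u\<in>X. dist (x j) u < e \<longrightarrow> u \<in> U j"
    proof (rule ex_common_radius)
      fix j assume "j \<in> {1..k+1}"
      then obtain V where V: "openin (top_of_set X) V" "x j \<in> V" "V \<subseteq> U j" using U by blast
      then obtain e where "e > 0" "\<forall>u\<in>X. dist u (x j) < e \<longrightarrow> u \<in> V"
        unfolding openin_euclidean_subtopology_iff by blast
      then show "\<exists>e>0. \<forall>u\<in>X. dist (x j) u < e \<longrightarrow> u \<in> U j"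
        using V by (metis dist_commute subsetD)
    qed auto
    then obtain \<rho> where "\<rho> > 0"
      and \<rho>: "\<And>j u. \<lbrakk>j \<in> {1..k+1}; u \<in> X; dist (x j) u < \<rho>\<rbrakk> \<Longrightarrow> u \<in> U j" by blast
    \<comment> \<open>With \<eta> at most \<open>\<epsilon> / 2\<close> and \<kappa> at most
      \<open>c / 8\<close>, the sum \<open>2 * \<epsilon> + 4 * \<eta> + 2 * \<kappa>\<close> is at
      most \<open>3 * c / 4\<close>, and \<open>\<epsilon> + \<eta>\<close> is below \<rho>.\<close>
    define \<epsilon> where "\<epsilon> = min (c / 8) (\<rho> / 4)"
    have \<epsilon>: "\<epsilon> > 0" "\<epsilon> \<le> c / 8" "\<epsilon> \<le> \<rho> / 4" using \<open>c > 0\<close> \<open>\<rho> > 0\<close> by (auto simp: \<epsilon>_def)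
    \<comment> \<open>The uniformity of \<delta> over all finite \<open>A\<close> is essential:
      \<open>A\<close> is chosen afterwards, as the set outside which the asymptotic pair is within
      \<open>\<delta> / 3\<close>.\<close>
    have "\<exists>\<delta>>0. \<forall>A. finite A \<and> A \<subseteq> carrier G \<longrightarrow> (\<exists>B. memory_set G X \<alpha> \<epsilon> \<delta> A B)"
      using assms(9)[unfolded topological_Markov_property_def] \<epsilon>(1) by simp
    then obtain \<delta> where "\<delta> > 0"
      and \<delta>: "\<And>A. finite A \<Longrightarrow> A \<subseteq> carrier G \<Longrightarrow> \<exists>B. memory_set G X \<alpha> \<epsilon> \<delta> A B"
      by (elim exE conjE) simp
    have "0 < \<delta> / 3" using \<open>\<delta> > 0\<close> by simp
    then have "\<exists>F. finite F \<and> F \<subseteq> carrier G \<and>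
        (\<forall>g\<in>carrier G - F. dist (\<alpha> g (x k)) (\<alpha> g (x (k + 1))) \<le> \<delta> / 3)"
      using assms(13) unfolding asymptotic_pair_def by (elim conjE allE[of _ "\<delta> / 3"]) (rule mp)
    then obtain A0 where A0: "finite A0" "A0 \<subseteq> carrier G"
      "\<And>g. g \<in> carrier G - A0 \<Longrightarrow> dist (\<alpha> g (x k)) (\<alpha> g (x (k + 1))) \<le> \<delta> / 3"
      by (elim exE conjE) simp
    \<comment> \<open>With the identity in \<open>A\<close>, a modification at a site controls the
      value at the vertex of that site.\<close>
    define A where "A = insert \<one>\<^bsub>G\<^esub> A0"
    have A: "finite A" "A \<subseteq> carrier G" using A0 by (auto simp: A_def)
    obtain B where B: "memory_set G X \<alpha> \<epsilon> \<delta> A B" using \<delta>[OF A] by blast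
    then have B_fin: "finite B" and B_carrier: "B \<subseteq> carrier G" by (auto simp: memory_set_def)
    \<comment> \<open>The budget \<delta> is split in three: asymptoticity off \<open>A\<close>,
      continuity at \<open>x k\<close> along the finite set \<open>B\<close>, and the slack
      \<eta>.\<close>
    have "\<exists>e>0. \<forall>b\<in>B. \<forall>u\<in>X. dist (x k) u < e \<longrightarrow> dist (\<alpha> b (x k)) (\<alpha> b u) \<le> \<delta> / 3"
    proof (rule ex_common_radius[OF B_fin])
      fix b assume "b \<in> B"
      then have "continuous_on X (\<alpha> b)" using B_carrier by (intro cont) blast
      from this[unfolded continuous_on_iff, THEN bspec, OF xk, THEN spec, THEN mp, OF \<open>0 < \<delta> / 3\<close>]
      obtain e where "e > 0" and e: "\<And>u. u \<in> X \<Longrightarrow> dist u (x k) < e \<Longrightarrow> dist (\<alpha> b u) (\<alpha> b (x k)) < \<delta> / 3"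
        by (elim exE conjE) simp
      show "\<exists>e>0. \<forall>u\<in>X. dist (x k) u < e \<longrightarrow> dist (\<alpha> b (x k)) (\<alpha> b u) \<le> \<delta> / 3"
      proof (intro exI[of _ e] conjI ballI impI)
        fix u assume "u \<in> X" "dist (x k) u < e"
        then show "dist (\<alpha> b (x k)) (\<alpha> b u) \<le> \<delta> / 3"
          using e[of u] by (simp add: dist_commute)
      qed fact
    qed auto
    then obtain t where "t > 0"
      and t: "\<And>b u. \<lbrakk>b \<in> B; u \<in> X; dist (x k) u < t\<rbrakk> \<Longrightarrow> dist (\<alpha> b (x k)) (\<alpha> b u) \<le> \<delta> / 3" by blast
    define \<kappa> where "\<kappa> = min (t / 2) (c / 8)"
    have \<kappa>: "\<kappa> > 0" "\<kappa> \<le> t / 2" "\<kappa> \<le> c / 8" using \<open>t > 0\<close> \<open>c > 0\<close> by (auto simp: \<kappa>_def)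
    define \<eta> where "\<eta> = min (\<epsilon> / 2) (\<delta> / 3)"
    have \<eta>: "\<eta> > 0" "\<eta> \<le> \<epsilon> / 2" "\<eta> \<le> \<delta> / 3" using \<epsilon> \<open>\<delta> > 0\<close> by (auto simp: \<eta>_def)
    obtain C where C: "finite C" "C \<subseteq> carrier G"
      "\<And>u w. \<lbrakk>u \<in> X; w \<in> X; \<And>g. g \<in> C \<Longrightarrow> dist (\<alpha> g u) (\<alpha> g w) \<le> c\<rbrakk> \<Longrightarrow> dist u w < \<eta>"
      using expansive_uniform[OF exp \<eta>(1)] by blast
    \<comment> \<open>The least set that meets \<open>B_subset_E\<close> and
      \<open>C_A_subset_E\<close>; it is finite, so only finitely many quotients arise.\<close>
    define E where "E = B \<union> (\<lambda>(d, a). inv\<^bsub>G\<^esub> d \<otimes>\<^bsub>G\<^esub> a) ` (C \<times> A)"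
    have "finite E" using B_fin C(1) A(1) by (simp add: E_def)
    interpret modification_setting G X \<alpha> c \<epsilon> \<eta> \<delta> A B C E "x (k + 1)"
    proof
      show "memory_set G X \<alpha> \<epsilon> \<delta> A B" by (rule B)
      show "E \<subseteq> carrier G" using B_carrier C(2) A(2) by (auto simp: E_def subset_iff)
      show "dist u w \<le> \<eta>" if "u \<in> X" "w \<in> X" "\<And>g. g \<in> C \<Longrightarrow> dist (\<alpha> g u) (\<alpha> g w) \<le> c" for u w
        using C(3)[OF that] by simp
      show "g \<in> E" if "g \<in> carrier G" "d \<in> C" "d \<otimes>\<^bsub>G\<^esub> g \<in> A" for g d
      proof -
        have "g = inv\<^bsub>G\<^esub> d \<otimes>\<^bsub>G\<^esub> (d \<otimes>\<^bsub>G\<^esub> g)" using that C(2) by (simp add: subset_iff flip: m_assoc)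
        then show ?thesis using that by (force simp: E_def)
      qed
    qed (use \<epsilon> \<eta> \<open>\<delta> > 0\<close> \<open>c > 0\<close> C xk1 in \<open>auto simp: E_def\<close>)
    \<comment> \<open>Radius of the smaller neighbourhoods: a further error \<eta> stays within
      \<rho>, and a further error \<kappa>, at most \<open>t / 2\<close>, stays strictly within
      \<open>t\<close>.\<close>
    define e where "e = min (\<rho> / 2) (t / 2)"
    have "e > 0" "e \<le> \<rho> / 2" "e \<le> t / 2" using \<open>\<rho> > 0\<close> \<open>t > 0\<close> by (auto simp: e_def)
    define U' where "U' j = X \<inter> ball (x j) e" for j
    show ?thesis
    proof (rule independence_transfer[where U' = U' and \<kappa> = \<kappa>])
      show "sofic_approximation G n \<sigma>" by (rule assms(5))
      show "\<exists>g\<in>carrier G. dist (\<alpha> g u) (\<alpha> g w) > c" if "u \<in> X" "w \<in> X" "u \<noteq> w" for u w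
        by (rule exp[OF that])
      show "\<one>\<^bsub>G\<^esub> \<in> A" by (simp add: A_def)
      show "finite E" by fact
      show "2 * \<epsilon> + 4 * \<eta> + 2 * \<kappa> \<le> c" using \<epsilon> \<eta> \<kappa> by linarith
      show "positive_upper_independence_density G X \<alpha> n \<sigma> k U'"
      proof -
        have "U' j \<subseteq> X \<and> (\<exists>V. openin (top_of_set X) V \<and> x j \<in> V \<and> V \<subseteq> U' j)" if "j \<in> {1..k}" for j
        proof -
          have "x j \<in> X" using assms(11) that by (auto simp: Pi_iff)
          then show ?thesis using \<open>e > 0\<close>
            by (intro conjI exI[of _ "U' j"]) (auto simp: U'_def openin_open_Int)
        qed
        then show ?thesis using assms(12) unfolding IE_tuples_def by blast
      qed
      show "dist (\<alpha> b (x (k + 1))) (\<alpha> b u) + \<eta> \<le> \<delta>"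
        if "a \<in> U' k" "u \<in> X" "dist a u \<le> \<kappa>" "b \<in> B - A" for a u b
      proof -
        have "dist (x k) u < t"
          using that dist_triangle[of "x k" u a] \<kappa> \<open>e \<le> t / 2\<close> by (auto simp: U'_def)
        then have "dist (\<alpha> b (x k)) (\<alpha> b u) \<le> \<delta> / 3" using t that by blast
        moreover have "dist (\<alpha> b (x k)) (\<alpha> b (x (k + 1))) \<le> \<delta> / 3"
          using that B_carrier by (intro A0) (auto simp: A_def)
        ultimately show ?thesis
          using dist_triangle3[of "\<alpha> b (x (k + 1))" "\<alpha> b u" "\<alpha> b (x k)"] \<eta>(3) by linarith
      qed
      show "u \<in> U j" if "j \<in> {1..k}" "a \<in> U' j" "u \<in> X" "dist a u \<le> \<eta>" for j a u
      proof (rule \<rho>)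
        show "dist (x j) u < \<rho>"
          using that dist_triangle[of "x j" u a] \<eta> \<epsilon> \<open>e \<le> \<rho> / 2\<close> by (auto simp: U'_def)
      qed (use that in auto)
      show "u \<in> U (k + 1)" if "u \<in> X" "dist (x (k + 1)) u \<le> \<epsilon> + \<eta>" for u
        using that \<epsilon> \<eta> by (intro \<rho>) auto
    qed (use \<kappa> assms(10) in auto)
  qed
  then show ?thesis using assms(11) unfolding IE_tuples_def by blast
qed

end
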